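(* Let $\tilde X$ be a Euclidean building and let $X=\tilde X/\Gamma$ be a compact quotient of $\tilde X$. Then $X$ has uniform finite blocking, i.e. there is an $N\in\mathbb{N}$ such that for every pair of (not necessarily distinct) points $x,y\in X$ the light $L(x,y)$ is blocked by some set of at most $N$ points of $X$.
   Context: Euclidean buildings. Let $W\subset\mathbb{R}^n$ be a compact (convex) polyhedron, all of whose faces form angles of the form $\pi/m_{ij}$ for positive integers $m_{ij}$. Let $\Lambda\subset \mathrm{Isom}(\mathbb{R}^n)$ be the Coxeter group generated by the reflections in the faces of $W$; the $\Lambda$-orbit of $W$ tessellates $\mathbb{R}^n$ by isometric copies of $W$. Faces of the copies of $W$ in this tessellation are labelled by the face of $W$ whose orbit contains them. A Euclidean building (in the standard sense, see Brown, Buildings) is a polyhedral complex $\tilde X$ equipped with a CAT(0) metric, in which each top dimensional polyhedron (chamber) is isometric to $W$, satisfying the usual building axioms; in particular: (i) each face of $\tilde X$ is labelled by one of the faces of $W$; (ii) for any $x,y\in\tilde X$ there is an isometric, polyhedral, label preserving embedding of the tessellated $\mathbb{R}^n$ into $\tilde X$ whose image contains $x$ and $y$ (the image of such an embedding is called an apartment); (iii) $\mathrm{Isom}(\tilde X)$ denotes the group of label preserving isometries of $\tilde X$; (iv) for any two apartments $A_1,A_2$ with non-empty intersection there is $\phi\in \mathrm{Isom}(\tilde X)$ fixing $A_1\cap A_2$ pointwise with $\phi(A_1)=A_2$. A compact quotient of $\tilde X$ is a quotient $X=\tilde X/\Gamma$ by a cocompact subgroup $\Gamma\subset \mathrm{Isom}(\tilde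 X)$ acting fixed point freely, with the induced length metric. Blocking. A geodesic segment in $X$ is a unit speed local geodesic $\gamma:[0,L_\gamma]\to X$ (equivalently, the image in $X$ of a geodesic segment of $\tilde X$), where $L_\gamma>0$ is its length; its interior is $\mathrm{int}(\gamma)=\gamma((0,L_\gamma))$. For $x,y\in X$, the light $L(x,y)$ is the set of geodesic segments $\gamma$ with $\gamma(0)=x$, $\gamma(L_\gamma)=y$ and $\mathrm{int}(\gamma)\cap\{x,y\}=\emptyset$. A set $B\subset X$ blocks $L(x,y)$ if $\mathrm{int}(\gamma)\cap B\neq\emptyset$ for every $\gamma\in L(x,y)$. *)

theory Defs
  imports "HOL-Analysis.Analysis" "HOL-Algebra.Generated_Groups"
begin

section \<open>Coxeter polytopes and their reflection groups\<close>

text \<open>\<open>u\<close> is the outward unit normal of \<open>W\<close> along the face \<open>F\<close>, which is cut out by the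
  supporting hyperplane \<open>u \<bullet> x = b\<close>.\<close>

definition supports_at :: "(real^'n) set \<Rightarrow> (real^'n) set \<Rightarrow> real^'n \<Rightarrow> real \<Rightarrow> bool" where
  "supports_at W F u b \<longleftrightarrow>
     norm u = 1 \<and> W \<subseteq> {x. u \<bullet> x \<le> b} \<and> F = W \<inter> {x. u \<bullet> x = b}"

text \<open>The interior dihedral angle between two facets is \<open>pi\<close> minus the angle between their outward
  normals. The condition is imposed where two facets meet along a face of codimension 2; parallel
  facets do not meet and form no angle. Nonemptiness of the intersection is needed in dimension 1,
  because \<open>aff_dim {} = -1\<close>.\<close>

definition coxeter_polytope :: "(real^'n) set \<Rightarrow> bool" where
  "coxeter_polytope W \<longleftrightarrow>
     polytope W \<and> interior W \<noteq> {} \<and>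
     (\<forall>F G u v b c.
        F facet_of W \<and> G facet_of W \<and> F \<noteq> G \<and>
        F \<inter> G \<noteq> {} \<and> aff_dim (F \<inter> G) = int CARD('n) - 2 \<and>
        supports_at W F u b \<and> supports_at W G v c
        \<longrightarrow> (\<exists>m::nat. m > 0 \<and> pi - arccos (u \<bullet> v) = pi / real m))"

definition isometry_group :: "('a::metric_space \<Rightarrow> 'a) monoid" where
  "isometry_group =
     \<lparr>carrier = {f. surj f \<and> (\<forall>x y. dist (f x) (f y) = dist x y)}, mult = (\<circ>), one = id\<rparr>"

definition facet_reflections :: "(real^'n) set \<Rightarrow> (real^'n \<Rightarrow> real^'n) set" where
  "facet_reflections W =
     {(\<lambda>x. x - (2 * (u \<bullet> x - b)) *\<^sub>R u) | F u b. F facet_of W \<and> supports_at W F u b}"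

definition coxeter_group :: "(real^'n) set \<Rightarrow> (real^'n \<Rightarrow> real^'n) set" where
  "coxeter_group W = generate isometry_group (facet_reflections W)"

section \<open>CAT(0) spaces\<close>

definition geodesic :: "(real \<Rightarrow> 'a::metric_space) \<Rightarrow> real \<Rightarrow> bool" where
  "geodesic c l \<longleftrightarrow> 0 \<le> l \<and> (\<forall>s\<in>{0..l}. \<forall>t\<in>{0..l}. dist (c s) (c t) = \<bar>s - t\<bar>)"

text \<open>\<open>P, Q, R\<close> is a comparison triangle in the Euclidean plane, \<open>S\<close> and \<open>T\<close> are the comparison
  points of \<open>c1 s\<close> and \<open>c2 t\<close>. Any two sides of a triangle share a vertex, so it is enough to
  compare points on two sides issuing from a common vertex.\<close>

definition CAT0 :: "'a::metric_space itself \<Rightarrow> bool" where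
  "CAT0 (_ :: 'a itself) \<longleftrightarrow>
     (\<forall>p q :: 'a. \<exists>c l. geodesic c l \<and> c 0 = p \<and> c l = q) \<and>
     (\<forall>(c1 :: real \<Rightarrow> 'a) l1 c2 l2.
        geodesic c1 l1 \<and> geodesic c2 l2 \<and> c1 0 = c2 0 \<longrightarrow>
        (\<forall>P Q R :: real^2. dist P Q = l1 \<and> dist P R = l2 \<and> dist Q R = dist (c1 l1) (c2 l2) \<longrightarrow>
           (\<forall>s\<in>{0..l1}. \<forall>t\<in>{0..l2}.
              \<forall>S\<in>closed_segment P Q. \<forall>T\<in>closed_segment P R.
                dist P S = s \<and> dist P T = t \<longrightarrow> dist (c1 s) (c2 t) \<le> dist S T)))"

section \<open>Polyhedral complexes\<close>

definition cell_chart ::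
    "(real^'n) set \<Rightarrow> (real^'n \<Rightarrow> 'x::metric_space) \<Rightarrow> 'x set \<Rightarrow> bool" where
  "cell_chart P f C \<longleftrightarrow> f ` P = C \<and> (\<forall>x\<in>P. \<forall>y\<in>P. dist (f x) (f y) = dist x y)"

definition cell_face :: "'n::finite itself \<Rightarrow> 'x::metric_space set \<Rightarrow> 'x set \<Rightarrow> bool" where
  "cell_face (_ :: 'n itself) F C \<longleftrightarrow>
     (\<exists>(P :: (real^'n) set) f G.
        polytope P \<and> cell_chart P f C \<and> G face_of P \<and> G \<noteq> {} \<and> F = f ` G)"

text \<open>Cells are nonempty; the type argument carries the dimension \<open>CARD('n)\<close>, which bounds the
  dimension of the cells.\<close>

definition polyhedral_complex :: "'n::finite itself \<Rightarrow> 'x::metric_space set set \<Rightarrow> bool" where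
  "polyhedral_complex (_ :: 'n itself) cells \<longleftrightarrow>
     \<Union>cells = UNIV \<and>
     (\<forall>C\<in>cells. C \<noteq> {} \<and> (\<exists>(P :: (real^'n) set) f. polytope P \<and> cell_chart P f C)) \<and>
     (\<forall>C\<in>cells. \<forall>F. cell_face TYPE('n) F C \<longrightarrow> F \<in> cells) \<and>
     (\<forall>C\<in>cells. \<forall>D\<in>cells.
        C \<inter> D = {} \<or> (cell_face TYPE('n) (C \<inter> D) C \<and> cell_face TYPE('n) (C \<inter> D) D))"

definition chamber :: "'n::finite itself \<Rightarrow> 'x::metric_space set set \<Rightarrow> 'x set \<Rightarrow> bool" where
  "chamber (_ :: 'n itself) cells C \<longleftrightarrow>
     C \<in> cells \<and>
     (\<exists>(P :: (real^'n) set) f. polytope P \<and> aff_dim P = int CARD('n) \<and> cell_chart P f C)"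

section \<open>Euclidean buildings\<close>

definition building_isometries ::
    "'x::metric_space set set \<Rightarrow> ('x set \<Rightarrow> (real^'n) set) \<Rightarrow> ('x \<Rightarrow> 'x) monoid" where
  "building_isometries cells label =
     isometry_group\<lparr>carrier :=
       {f \<in> carrier isometry_group.
          (\<lambda>C. f ` C) ` cells = cells \<and> (\<forall>C\<in>cells. label (f ` C) = label C)}\<rparr>"

text \<open>The cells of the tessellation of Euclidean space are the sets \<open>g ` F\<close> with \<open>g\<close> in the Coxeter
  group and \<open>F\<close> a nonempty face of \<open>W\<close>; the label of \<open>g ` F\<close> is \<open>F\<close>.\<close>

definition apartment_embedding ::
    "(real^'n) set \<Rightarrow> 'x::metric_space set set \<Rightarrow> ('x set \<Rightarrow> (real^'n) set)
      \<Rightarrow> (real^'n \<Rightarrow> 'x) \<Rightarrow> bool" where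
  "apartment_embedding W cells label \<phi> \<longleftrightarrow>
     (\<forall>x y. dist (\<phi> x) (\<phi> y) = dist x y) \<and>
     (\<forall>g\<in>coxeter_group W. \<forall>F. F face_of W \<and> F \<noteq> {} \<longrightarrow>
        \<phi> ` g ` F \<in> cells \<and> label (\<phi> ` g ` F) = F)"

definition apartment ::
    "(real^'n) set \<Rightarrow> 'x::metric_space set set \<Rightarrow> ('x set \<Rightarrow> (real^'n) set) \<Rightarrow> 'x set \<Rightarrow> bool" where
  "apartment W cells label A \<longleftrightarrow> (\<exists>\<phi>. apartment_embedding W cells label \<phi> \<and> A = range \<phi>)"

definition euclidean_building ::
    "(real^'n) set \<Rightarrow> 'x::metric_space set set \<Rightarrow> ('x set \<Rightarrow> (real^'n) set) \<Rightarrow> bool" where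
  "euclidean_building W cells label \<longleftrightarrow>
     coxeter_polytope W \<and>
     CAT0 TYPE('x) \<and>
     polyhedral_complex TYPE('n) cells \<and>
     (\<forall>C. chamber TYPE('n) cells C \<longrightarrow> (\<exists>f. cell_chart W f C)) \<and>
     (\<forall>C\<in>cells. label C face_of W \<and> label C \<noteq> {}) \<and>
     (\<forall>x y. \<exists>A. apartment W cells label A \<and> x \<in> A \<and> y \<in> A) \<and>
     (\<forall>A1 A2. apartment W cells label A1 \<and> apartment W cells label A2 \<and> A1 \<inter> A2 \<noteq> {} \<longrightarrow>
        (\<exists>f\<in>carrier (building_isometries cells label).
           (\<forall>x\<in>A1 \<inter> A2. f x = x) \<and> f ` A1 = A2))"

section \<open>Compact quotients\<close>

definition orbit_space :: "('x \<Rightarrow> 'x) set \<Rightarrow> 'x set set" where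
  "orbit_space \<Gamma> = range (\<lambda>x. (\<lambda>g. g x) ` \<Gamma>)"

text \<open>The metric on the orbit space is \<open>setdist\<close>, the infimum of the distances between points of
  the two orbits. As the building is a geodesic space, this is the length metric induced on the
  quotient.\<close>

definition compact_quotient ::
    "'x::metric_space set set \<Rightarrow> ('x set \<Rightarrow> (real^'n) set) \<Rightarrow> ('x \<Rightarrow> 'x) set \<Rightarrow> bool" where
  "compact_quotient cells label \<Gamma> \<longleftrightarrow>
     subgroup \<Gamma> (building_isometries cells label) \<and>
     (\<forall>g\<in>\<Gamma>. g \<noteq> id \<longrightarrow> (\<forall>x. g x \<noteq> x)) \<and>
     compact_space (Metric_space.mtopology (orbit_space \<Gamma>) setdist)"

section \<open>Blocking light\<close>

definition geodesic_segment ::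
    "'a set \<Rightarrow> ('a \<Rightarrow> 'a \<Rightarrow> real) \<Rightarrow> (real \<Rightarrow> 'a) \<Rightarrow> real \<Rightarrow> bool" where
  "geodesic_segment X d \<gamma> L \<longleftrightarrow>
     L > 0 \<and> \<gamma> ` {0..L} \<subseteq> X \<and>
     (\<forall>t\<in>{0..L}. \<exists>e>0. \<forall>r\<in>{0..L}. \<forall>s\<in>{0..L}.
        \<bar>r - t\<bar> < e \<and> \<bar>s - t\<bar> < e \<longrightarrow> d (\<gamma> r) (\<gamma> s) = \<bar>r - s\<bar>)"

text \<open>A segment is recorded as a pair of a path and its length \<open>L\<close>; the values of the path outside
  \<open>{0..L}\<close> are irrelevant.\<close>

definition light ::
    "'a set \<Rightarrow> ('a \<Rightarrow> 'a \<Rightarrow> real) \<Rightarrow> 'a \<Rightarrow> 'a \<Rightarrow> ((real \<Rightarrow> 'a) \<times> real) set" where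
  "light X d x y =
     {(\<gamma>, L). geodesic_segment X d \<gamma> L \<and> \<gamma> 0 = x \<and> \<gamma> L = y \<and> \<gamma> ` {0<..<L} \<inter> {x, y} = {}}"

definition blocks :: "'a set \<Rightarrow> ((real \<Rightarrow> 'a) \<times> real) set \<Rightarrow> bool" where
  "blocks B \<L> \<longleftrightarrow> (\<forall>(\<gamma>, L)\<in>\<L>. \<gamma> ` {0<..<L} \<inter> B \<noteq> {})"

definition uniform_finite_blocking :: "'a set \<Rightarrow> ('a \<Rightarrow> 'a \<Rightarrow> real) \<Rightarrow> bool" where
  "uniform_finite_blocking X d \<longleftrightarrow>
     (\<exists>N::nat. \<forall>x\<in>X. \<forall>y\<in>X. \<exists>B. B \<subseteq> X \<and> finite B \<and> card B \<le> N \<and> blocks B (light X d x y))"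

end

theory Submission
  imports Defs
begin

text \<open>Every point of the building has a type in \<open>W\<close>, preserved by \<open>\<Gamma>\<close>: its preimage under an
  apartment embedding that maps \<open>W\<close> onto a chamber containing the point. A light ray lifts to a
  geodesic of the building, which lies in an apartment and is a straight segment there, so its
  midpoint has type \<open>(a p + b q) / 2\<close> with \<open>p\<close>, \<open>q\<close> the types of its endpoints and \<open>a\<close>, \<open>b\<close> in
  the Coxeter group. As the linear parts of the Coxeter group are finite in number and its
  translations are discrete, only boundedly many such points lie in \<open>W\<close>. Each type is attained at
  no more points of the compact quotient than there are chambers, so the points with these types
  block the light.\<close>

section \<open>Isometries of Euclidean space\<close>

text \<open>The labelling makes types rigid: two chambers that meet share a face carrying one label,
  so their charts agree on it. Comparing an apartment chart with its composite with a Coxeter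
  element shows that a nontrivial element moves no point of \<open>W\<close> into the interior of
  \<open>W\<close>. Discreteness of the Coxeter group is read off the building in this way, and the
  separation constants below descend from it.

  The bound has to be independent of the endpoints although segments are arbitrarily long. Midpoints
  achieve this: the elements \<open>a\<close> and \<open>b\<close> are individually unbounded, but
  requiring their midpoint to lie in \<open>W\<close> confines the sum of their translation parts.

  Freeness of the action enters through a positive displacement at each point, which makes the orbit
  map isometric on small balls. Local geodesics of the quotient therefore lift to local geodesics,
  and the CAT(0) inequality makes the lifts globally geodesic.\<close>

lemma stewart:
  fixes a b c :: "'a::real_inner"
  shows "(norm (c - ((1 - t) *\<^sub>R a + t *\<^sub>R b)))\<^sup>2 =
    (1 - t) * (norm (c - a))\<^sup>2 + t * (norm (c - b))\<^sup>2 - t * (1 - t) * (norm (a - b))\<^sup>2"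
  unfolding power2_norm_eq_inner
  by (simp add: inner_diff_left inner_diff_right inner_add_left inner_add_right inner_commute
      algebra_simps power2_eq_square)

text \<open>By Stewart's identity, distances to \<open>h x\<close> and \<open>h y\<close> determine
  the distance from \<open>h z\<close> to the expected point, and the same expression in the domain
  is 0. Neither surjectivity nor values outside \<open>S\<close> enter.\<close>

lemma isometric_on_convex_affine:
  fixes h :: "'a::real_inner \<Rightarrow> 'b::real_inner"
  assumes iso: "\<And>x y. x \<in> S \<Longrightarrow> y \<in> S \<Longrightarrow> dist (h x) (h y) = dist x y"
    and "convex S" "x \<in> S" "y \<in> S" "0 \<le> t" "t \<le> 1"
  shows "h ((1 - t) *\<^sub>R x + t *\<^sub>R y) = (1 - t) *\<^sub>R h x + t *\<^sub>R h y"
proof -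
  define z where "z = (1 - t) *\<^sub>R x + t *\<^sub>R y"
  have z: "z \<in> S"
    using assms unfolding z_def by (simp add: convexD_alt)
  have "(norm (h z - ((1 - t) *\<^sub>R h x + t *\<^sub>R h y)))\<^sup>2 =
      (1 - t) * (norm (z - x))\<^sup>2 + t * (norm (z - y))\<^sup>2 - t * (1 - t) * (norm (x - y))\<^sup>2"
    unfolding stewart using iso[OF z \<open>x \<in> S\<close>] iso[OF z \<open>y \<in> S\<close>] iso[OF \<open>x \<in> S\<close> \<open>y \<in> S\<close>]
    by (simp add: dist_norm)
  also have "\<dots> = (norm (z - ((1 - t) *\<^sub>R x + t *\<^sub>R y)))\<^sup>2"
    by (simp only: stewart)
  also have "\<dots> = 0"
    by (simp add: z_def)
  finally show ?thesis
    by (simp add: z_def)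
qed

lemma isometric_fixes_hull:
  fixes h :: "'a::real_inner \<Rightarrow> 'a"
  assumes iso: "\<And>x y. x \<in> S \<Longrightarrow> y \<in> S \<Longrightarrow> dist (h x) (h y) = dist x y"
    and "convex S" "E \<subseteq> S" and fixed: "\<And>x. x \<in> E \<Longrightarrow> h x = x" and "x \<in> convex hull E"
  shows "h x = x"
proof -
  have "convex {x \<in> S. h x = x}"
    unfolding convex_alt using isometric_on_convex_affine[OF iso \<open>convex S\<close>] \<open>convex S\<close>
    by (auto simp: convexD_alt)
  then have "convex hull E \<subseteq> {x \<in> S. h x = x}"
    using assms by (intro hull_minimal) auto
  then show ?thesis
    using assms by auto
qed

text \<open>Faces are defined through open segments, and an isometric map of a convex set both
  preserves and reflects these.\<close>

lemma isometric_image_face: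
  fixes h :: "'a::real_inner \<Rightarrow> 'b::real_inner"
  assumes iso: "\<And>x y. x \<in> S \<Longrightarrow> y \<in> S \<Longrightarrow> dist (h x) (h y) = dist x y"
    and "convex S" "G face_of S"
  shows "h ` G face_of h ` S"
  unfolding face_of_def
proof (intro conjI ballI impI)
  have G: "G \<subseteq> S" "convex G"
    using assms by (auto simp: face_of_def)
  then show "h ` G \<subseteq> h ` S"
    by auto
  show "convex (h ` G)"
    unfolding convex_alt
  proof clarsimp
    fix x y :: 'a and t :: real
    assume *: "x \<in> G" "y \<in> G" "0 \<le> t" "t \<le> 1"
    then show "(1 - t) *\<^sub>R h x + t *\<^sub>R h y \<in> h ` G"
      using isometric_on_convex_affine[OF iso \<open>convex S\<close>, of x y t] G
      by (metis convexD_alt image_eqI subsetD)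
  qed
next
  fix a b z
  assume "a \<in> h ` S" "b \<in> h ` S" "z \<in> h ` G" "z \<in> open_segment a b"
  then obtain x y w where *: "x \<in> S" "y \<in> S" "w \<in> G" "a = h x" "b = h y" "z = h w"
    and z: "h w \<in> open_segment (h x) (h y)"
    by auto
  have w: "w \<in> S"
    using * assms(3) by (auto simp: face_of_def)
  obtain t where t: "h x \<noteq> h y" "0 < t" "t < 1" "h w = (1 - t) *\<^sub>R h x + t *\<^sub>R h y"
    using z by (auto simp: in_segment)
  then have "h w = h ((1 - t) *\<^sub>R x + t *\<^sub>R y)"
    using isometric_on_convex_affine[OF iso assms(2) *(1,2), of t] by auto
  then have "w = (1 - t) *\<^sub>R x + t *\<^sub>R y"
    using iso[OF w, of "(1 - t) *\<^sub>R x + t *\<^sub>R y"] t * \<open>convex S\<close> by (simp add: convexD_alt)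
  then have "w \<in> open_segment x y"
    using t by (auto simp: in_segment)
  then have "x \<in> G \<and> y \<in> G"
    using * assms(3) by (auto simp: face_of_def)
  with * show "a \<in> h ` G" "b \<in> h ` G"
    by auto
qed

lemma group_isometry_group: "group (isometry_group :: ('a::metric_space \<Rightarrow> 'a) monoid)"
proof (rule groupI)
  fix f :: "'a \<Rightarrow> 'a" assume "f \<in> carrier isometry_group"
  then have f: "surj f" "\<And>x y. dist (f x) (f y) = dist x y"
    by (auto simp: isometry_group_def)
  then have "inj f"
    by (metis dist_eq_0_iff injI)
  then have "bij f"
    using f by (simp add: bij_def)
  then have "inv_into UNIV f \<in> carrier isometry_group" "inv_into UNIV f \<circ> f = id"
    using f(1) \<open>inj f\<close> \<open>bij f\<close> f(2)[of "inv_into UNIV f _" "inv_into UNIV f _"]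
    by (auto simp: isometry_group_def bij_is_surj bij_imp_bij_inv surj_f_inv_f)
  then show "\<exists>g\<in>carrier isometry_group. g \<otimes>\<^bsub>isometry_group\<^esub> f = \<one>\<^bsub>isometry_group\<^esub>"
    by (auto simp: isometry_group_def)
qed (simp_all add: isometry_group_def comp_surj[unfolded o_def] o_assoc)

lemma bounded_separated_imp_finite:
  fixes A :: "'a::euclidean_space set"
  assumes "bounded A" "0 < r" "\<And>x y. x \<in> A \<Longrightarrow> y \<in> A \<Longrightarrow> x \<noteq> y \<Longrightarrow> r \<le> dist x y"
  shows "finite A"
proof (rule ccontr)
  assume "infinite A"
  moreover have "compact (closure A)"
    using assms(1) by (simp add: compact_closure)
  ultimately obtain l where "l islimpt A"
    using closure_subset Heine_Borel_imp_Bolzano_Weierstrass[of "closure A" A] by blast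
  then obtain x where x: "x \<in> A" "x \<noteq> l" "dist x l < r / 2"
    using assms(2) by (meson islimpt_approachable half_gt_zero)
  \<comment> \<open>Choosing \<open>y\<close> strictly closer to \<open>l\<close> than
    \<open>x\<close> forces the two points to differ.\<close>
  with \<open>l islimpt A\<close> obtain y where "y \<in> A" "y \<noteq> l" "dist y l < min (dist x l) (r/2)"
    by (metis islimpt_approachable min_less_iff_conj dist_nz assms(2) half_gt_zero)
  then have "x \<noteq> y" "dist x y < r"
    using x dist_triangle2[of x y l] by auto
  with assms(3) x \<open>y \<in> A\<close> show False
    by fastforce
qed

section \<open>Reflections and linear parts\<close>

definition reflection :: "'a::real_inner \<Rightarrow> real \<Rightarrow> 'a \<Rightarrow> 'a" where
  "reflection u b = (\<lambda>x. x - (2 * (u \<bullet> x - b)) *\<^sub>R u)"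

definition linear_part :: "('a::real_vector \<Rightarrow> 'b::real_vector) \<Rightarrow> 'a \<Rightarrow> 'b" where
  "linear_part g = (\<lambda>x. g x - g 0)"

text \<open>The extra term is negative when \<open>x\<close> and \<open>y\<close> lie strictly on
  opposite sides of the wall: reflecting \<open>x\<close> then brings it closer to \<open>y\<close>.
  This drives \<open>coxeter_covers\<close>.\<close>

lemma dist_reflection_sq:
  assumes "norm u = 1"
  shows "(dist (reflection u b x) y)\<^sup>2 = (dist x y)\<^sup>2 + 4 * (u \<bullet> x - b) * (u \<bullet> y - b)"
proof -
  have "u \<bullet> u = 1"
    using assms by (simp add: norm_eq_1)
  then show ?thesis
    unfolding reflection_def dist_norm power2_norm_eq_inner
    by (simp add: inner_diff_left inner_diff_right inner_commute algebra_simps power2_eq_square)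
qed

lemma reflection_inner:
  assumes "norm u = 1"
  shows "u \<bullet> reflection u b x - b = - (u \<bullet> x - b)"
  using assms by (simp add: reflection_def inner_diff_right norm_eq_1)

lemma dist_reflection:
  assumes "norm u = 1"
  shows "dist (reflection u b x) (reflection u b y) = dist x y"
proof -
  have "(dist (reflection u b x) (reflection u b y))\<^sup>2 = (dist x y)\<^sup>2"
    using dist_reflection_sq[OF assms, of b y x]
    by (simp add: dist_reflection_sq[OF assms] reflection_inner[OF assms] dist_commute algebra_simps)
  then show ?thesis
    by simp
qed

lemma reflection_reflection:
  assumes "norm u = 1"
  shows "reflection u b (reflection u b x) = x"
proof -
  have "reflection u b (reflection u b x) = 
      reflection u b x - (2 * (u \<bullet> reflection u b x - b)) *\<^sub>R u"
    by (simp add: reflection_def)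
  also have "\<dots> = x"
    unfolding reflection_inner[OF assms] mult_minus_right scaleR_minus_left
    by (simp add: reflection_def)
  finally show ?thesis .
qed

lemma linear_part_isometry:
  fixes g :: "'a::real_inner \<Rightarrow> 'a"
  assumes "\<And>x y. dist (g x) (g y) = dist x y"
  shows "orthogonal_transformation (linear_part g)"
  unfolding orthogonal_transformation_isometry using assms
  by (simp add: linear_part_def dist_norm)

lemma linear_part_reflection:
  "linear_part (reflection u b) x = x - (2 * (u \<bullet> x)) *\<^sub>R u"
  by (simp add: linear_part_def reflection_def algebra_simps)

text \<open>Evaluating both linear parts at \<open>u\<close> shows that \<open>u\<close> is a
  multiple of \<open>v\<close>. Finiteness of a set of reflections thus passes to their unit
  normals.\<close>

lemma reflection_eq_imp:
  assumes "norm u = 1" "norm v = 1" "reflection u b = reflection v c"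
  shows "u = v \<or> u = - v"
proof -
  have "u - (2 * (u \<bullet> u)) *\<^sub>R u = u - (2 * (v \<bullet> u)) *\<^sub>R v"
    using assms(3) linear_part_reflection[of u b u] linear_part_reflection[of v c u] by simp
  then have "2 *\<^sub>R u = 2 *\<^sub>R ((v \<bullet> u) *\<^sub>R v)"
    using assms by (simp add: norm_eq_1)
  then have u: "u = (v \<bullet> u) *\<^sub>R v"
    by (simp only: scaleR_cancel_left) simp
  then have "1 = \<bar>v \<bullet> u\<bar>"
    using assms by (metis mult.right_neutral norm_scaleR)
  then have "v \<bullet> u = 1 \<or> v \<bullet> u = -1"
    by linarith
  with u show ?thesis
    by (metis scaleR_minus1_left scaleR_one)
qed

text \<open>The new offset is the constant value of the rotated normal on the image of the wall,
  since \<open>g x\<close> is \<open>linear_part g x + g 0\<close>.\<close>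

lemma isometry_conj_reflection:
  fixes g :: "'a::real_inner \<Rightarrow> 'a"
  assumes iso: "\<And>x y. dist (g x) (g y) = dist x y"
  shows "g (reflection u b x) =
    reflection (linear_part g u) (b + linear_part g u \<bullet> g 0) (g x)"
proof -
  let ?A = "linear_part g"
  have A: "orthogonal_transformation ?A"
    using assms by (rule linear_part_isometry)
  then have lin: "linear ?A" and inn: "\<And>v w. ?A v \<bullet> ?A w = v \<bullet> w"
    by (auto simp: orthogonal_transformation_def)
  have g: "g y = ?A y + g 0" for y
    by (simp add: linear_part_def)
  show ?thesis
    unfolding reflection_def g[of "x - _"] g[of x]
    by (simp add: linear_diff[OF lin] linear_scale[OF lin] inner_add_right inn)
qed

text \<open>Cramer's rule in the span of \<open>u\<close> and \<open>v\<close>; the Gram determinant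
  \<open>1 - ?d * ?d\<close> vanishes only for parallel unit vectors.\<close>

lemma two_hyperplanes_meet:
  fixes u v :: "'a::real_inner"
  assumes "norm u = 1" "norm v = 1" "u \<noteq> v" "u \<noteq> - v"
  obtains x where "u \<bullet> x = b" "v \<bullet> x = c"
proof -
  let ?d = "u \<bullet> v"
  have uv: "u \<bullet> u = 1" "v \<bullet> v = 1"
    using assms by (auto simp: norm_eq_1)
  have "(u - v) \<bullet> (u - v) \<noteq> 0" "(u + v) \<bullet> (u + v) \<noteq> 0"
    using assms by (auto simp: add_eq_0_iff2)
  then have "?d \<noteq> 1" "?d \<noteq> -1"
    using uv by (auto simp: inner_diff_left inner_diff_right inner_add_left inner_add_right
        inner_commute)
  then have d: "1 - ?d * ?d \<noteq> 0"
    by (simp add: square_eq_1_iff)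
  let ?x = "((b - c * ?d) / (1 - ?d * ?d)) *\<^sub>R u + ((c - b * ?d) / (1 - ?d * ?d)) *\<^sub>R v"
  have "u \<bullet> ?x = b" "v \<bullet> ?x = c"
    using d uv by (simp_all add: inner_add_right inner_commute[of v u] divide_simps)
      (simp_all add: algebra_simps)
  then show ?thesis
    by (rule that)
qed

text \<open>In an irredundant description by half-spaces every half-space cuts out a facet, and
  \<open>p\<close> violates one of them. Rescaling its normal to length 1 gives \<open>u\<close> and
  \<open>b\<close>.\<close>

lemma polytope_facet_normal:
  fixes W :: "(real^'n) set"
  assumes W: "polytope W" "interior W \<noteq> {}" "p \<notin> W"
  obtains F u b where "F facet_of W" "supports_at W F u b" "b < u \<bullet> p"
proof -
  have aff: "affine hull W = UNIV"
    using assms by (simp add: affine_hull_nonempty_interior)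
  obtain H where H: "finite H" "W = affine hull W \<inter> \<Inter>H"
      "\<forall>h\<in>H. \<exists>a b. a \<noteq> 0 \<and> h = {x. a \<bullet> x \<le> b}" 
      "\<And>H'. H' \<subset> H \<Longrightarrow> W \<subset> affine hull W \<inter> \<Inter>H'"
    using polytope_imp_polyhedron[OF W(1)] unfolding polyhedron_Int_affine_minimal by metis
  obtain a b where ab: "\<And>h. h \<in> H \<Longrightarrow> a h \<noteq> 0 \<and> h = {x. a h \<bullet> x \<le> b h}"
    using H(3) by metis
  have WH: "W = \<Inter>H"
    using H(2) aff by simp
  then obtain h where h: "h \<in> H" "p \<notin> h"
    using W(3) by auto
  define F where "F = W \<inter> {x. a h \<bullet> x = b h}"
  have F: "F facet_of W"
    using facet_of_polyhedron_explicit[OF H(1,2) ab H(4), of F] h F_def by blast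
  define n where "n = norm (a h)"
  have n: "0 < n"
    using ab[OF h(1)] by (simp add: n_def)
  have "W \<subseteq> h"
    using WH h by auto
  then have Wh: "a h \<bullet> x \<le> b h" if "x \<in> W" for x
    using that ab[OF h(1)] by blast
  have "supports_at W F (a h /\<^sub>R n) (b h / n)"
    unfolding supports_at_def F_def using n Wh
    by (auto simp: n_def divide_simps)
  moreover have "b h / n < (a h /\<^sub>R n) \<bullet> p"
    using ab[OF h(1)] h(2) n by (auto simp: divide_simps)
  ultimately show ?thesis
    using F that by blast
qed

section \<open>The Coxeter group\<close>

lemma facet_reflections_eq:
  "facet_reflections W = {reflection u b | F u b. F facet_of W \<and> supports_at W F u b}"
  by (simp add: facet_reflections_def reflection_def)

lemma subgroup_coxeter_group: "subgroup (coxeter_group W) isometry_group"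
proof -
  have "reflection u b \<in> carrier isometry_group" if "norm u = 1" for u :: "real^'n" and b
  proof -
    have "surj (reflection u b)"
      using reflection_reflection[OF that] by (metis surjI)
    with that show ?thesis
      by (simp add: isometry_group_def dist_reflection)
  qed
  then have "facet_reflections W \<subseteq> carrier isometry_group"
    by (auto simp: facet_reflections_eq supports_at_def)
  then show ?thesis
    unfolding coxeter_group_def by (rule group.generate_is_subgroup[OF group_isometry_group])
qed

lemma coxeter_group_id: "id \<in> coxeter_group W"
  using subgroup.one_closed[OF subgroup_coxeter_group] by (simp add: isometry_group_def)

lemma coxeter_group_comp:
  "g \<in> coxeter_group W \<Longrightarrow> h \<in> coxeter_group W \<Longrightarrow> g \<circ> h \<in> coxeter_group W"
  using subgroup.m_closed[OF subgroup_coxeter_group] by (simp add: isometry_group_def)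

lemma coxeter_group_isometry: "g \<in> coxeter_group W \<Longrightarrow> dist (g x) (g y) = dist x y"
  using subgroup.subset[OF subgroup_coxeter_group, of W] by (auto simp: isometry_group_def)

lemma coxeter_group_inverse:
  assumes "g \<in> coxeter_group W"
  obtains h where "h \<in> coxeter_group W" "\<And>x. g (h x) = x" "\<And>x. h (g x) = x"
proof
  let ?h = "inv\<^bsub>isometry_group\<^esub> g"
  have g: "g \<in> carrier isometry_group"
    using assms subgroup.subset[OF subgroup_coxeter_group] by auto
  show "?h \<in> coxeter_group W"
    using assms by (rule subgroup.m_inv_closed[OF subgroup_coxeter_group])
  have "g \<circ> ?h = id" "?h \<circ> g = id"
    using group.r_inv[OF group_isometry_group g] group.l_inv[OF group_isometry_group g]
    by (simp_all add: isometry_group_def)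
  then show "g (?h x) = x" "?h (g x) = x" for x
    by (metis comp_apply id_apply)+
qed

lemma reflection_in_coxeter_group:
  "F facet_of W \<Longrightarrow> supports_at W F u b \<Longrightarrow> reflection u b \<in> coxeter_group W"
  unfolding coxeter_group_def by (rule generate.incl) (auto simp: facet_reflections_eq)

section \<open>Charts of a building\<close>

text \<open>\<open>cell_face\<close> allows an arbitrary chart of the cell. The transition map from
  that chart to \<open>f\<close> is an isometry of polytopes and carries faces to faces, so faces
  can be read off in any chosen chart.\<close>

lemma cell_face_chart:
  fixes W :: "(real^'n) set"
  assumes "cell_chart W f C" "cell_face TYPE('n) D C"
  obtains G where "G face_of W" "G \<noteq> {}" "D = f ` G"
proof -
  obtain P :: "(real^'n) set" and p G where P: "polytope P" "cell_chart P p C" "G face_of P"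
      "G \<noteq> {}" "D = p ` G"
    using assms(2) unfolding cell_face_def by blast
  define k where "k = inv_into W f \<circ> p"
  have f: "f ` W = C" "\<And>x y. x \<in> W \<Longrightarrow> y \<in> W \<Longrightarrow> dist (f x) (f y) = dist x y"
    and p: "p ` P = C" "\<And>x y. x \<in> P \<Longrightarrow> y \<in> P \<Longrightarrow> dist (p x) (p y) = dist x y"
    using assms(1) P(2) by (auto simp: cell_chart_def)
  have kW: "k x \<in> W" and fk: "f (k x) = p x" if "x \<in> P" for x
    using that f(1) p(1) unfolding k_def
    by (auto intro!: inv_into_into f_inv_into_f)
  have iso: "dist (k x) (k y) = dist x y" if "x \<in> P" "y \<in> P" for x y
    using that f(2)[of "k x" "k y"] kW fk p(2) by simp
  have "k ` P = W"
  proof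
    show "W \<subseteq> k ` P"
    proof
      fix w assume "w \<in> W"
      then obtain x where x: "x \<in> P" "p x = f w"
        using f(1) p(1) by (metis imageE imageI)
      then have "dist (k x) w = 0"
        using f(2)[of "k x" w] fk kW \<open>w \<in> W\<close> by simp
      with x show "w \<in> k ` P"
        by auto
    qed
  qed (use kW in auto)
  moreover have "k ` G face_of k ` P"
    using isometric_image_face[OF iso] P(1,3) by (simp add: polytope_imp_convex)
  moreover have "f ` k ` G = D"
    unfolding image_image P(5) using fk face_of_imp_subset[OF P(3)] by (intro image_cong) auto
  ultimately show ?thesis
    using that[of "k ` G"] P(4) by auto
qed

section \<open>Apartment charts restricted to the model chamber\<close>

locale coxeter_building =
  fixes W :: "(real^'n) set"
    and cells :: "'x::metric_space set set"
    and label :: "'x set \<Rightarrow> (real^'n) set"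
  assumes building: "euclidean_building W cells label"
begin

abbreviation emb :: "(real^'n \<Rightarrow> 'x) \<Rightarrow> bool" where
  "emb \<equiv> apartment_embedding W cells label"

lemma polytope_W: "polytope W" and interior_W: "interior W \<noteq> {}"
  and CAT0: "CAT0 TYPE('x)" and complex: "polyhedral_complex TYPE('n) cells"
  using building by (auto simp: euclidean_building_def coxeter_polytope_def)

lemma convex_W: "convex W"
  using polytope_W by (rule polytope_imp_convex)

lemma compact_W: "compact W"
  using polytope_W by (rule polytope_imp_compact)

lemma common_apartment:
  obtains \<phi> p q where "emb \<phi>" "x = \<phi> p" "y = \<phi> q"
proof -
  have "\<exists>A. apartment W cells label A \<and> x \<in> A \<and> y \<in> A"
    using building by (simp add: euclidean_building_def)
  then show ?thesis
    using that unfolding apartment_def by blast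
qed

lemma emb_isometry: "emb \<phi> \<Longrightarrow> dist (\<phi> x) (\<phi> y) = dist x y"
  by (simp add: apartment_embedding_def)

lemma emb_eq_iff: "emb \<phi> \<Longrightarrow> \<phi> x = \<phi> y \<longleftrightarrow> x = y"
  by (metis dist_eq_0_iff emb_isometry)

lemma emb_cell: "emb \<phi> \<Longrightarrow> F face_of W \<Longrightarrow> F \<noteq> {} \<Longrightarrow> \<phi> ` F \<in> cells"
  and emb_label: "emb \<phi> \<Longrightarrow> F face_of W \<Longrightarrow> F \<noteq> {} \<Longrightarrow> label (\<phi> ` F) = F"
  using coxeter_group_id[of W] unfolding apartment_embedding_def by force+

lemma emb_comp:
  assumes "emb \<phi>" "g \<in> coxeter_group W"
  shows "emb (\<phi> \<circ> g)"
proof -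
  have "(\<phi> \<circ> g) ` h ` F \<in> cells \<and> label ((\<phi> \<circ> g) ` h ` F) = F"
    if "h \<in> coxeter_group W" "F face_of W \<and> F \<noteq> {}" for h F
  proof -
    have "(\<phi> \<circ> g) ` h ` F = \<phi> ` (g \<circ> h) ` F"
      by (simp add: image_comp o_assoc)
    moreover have "\<phi> ` (g \<circ> h) ` F \<in> cells \<and> label (\<phi> ` (g \<circ> h) ` F) = F"
      using assms(1) coxeter_group_comp[OF assms(2) that(1)] that(2)
      unfolding apartment_embedding_def by blast
    ultimately show ?thesis
      by simp
  qed
  then show ?thesis
    using emb_isometry[OF assms(1)] coxeter_group_isometry[OF assms(2)]
    by (simp add: apartment_embedding_def)
qed

text \<open>Labels determine the vertices of a common cell, and a Euclidean isometry of a polytope that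
  fixes the vertices is the identity.\<close>

lemma emb_Int:
  assumes "emb \<phi>" "emb \<psi>" "\<phi> ` W \<inter> \<psi> ` W \<noteq> {}"
  obtains G where "G face_of W" "\<phi> ` W \<inter> \<psi> ` W = \<phi> ` G" "\<forall>x\<in>G. \<phi> x = \<psi> x"
proof -
  let ?D = "\<phi> ` W \<inter> \<psi> ` W"
  have W: "W face_of W" "W \<noteq> {}"
    using convex_W interior_W interior_subset by (auto simp: face_of_refl)
  have "C \<inter> D = {} \<or> (cell_face TYPE('n) (C \<inter> D) C \<and> cell_face TYPE('n) (C \<inter> D) D)"
    if "C \<in> cells" "D \<in> cells" for C D
    using complex that by (simp add: polyhedral_complex_def)
  from this[OF emb_cell[OF assms(1) W] emb_cell[OF assms(2) W]]
  have "cell_face TYPE('n) ?D (\<phi> ` W)" "cell_face TYPE('n) ?D (\<psi> ` W)"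
    using assms(3) by auto
  moreover have "cell_chart W \<phi> (\<phi> ` W)" "cell_chart W \<psi> (\<psi> ` W)"
    using assms by (auto simp: cell_chart_def emb_isometry)
  ultimately obtain G G' where G: "G face_of W" "G \<noteq> {}" "?D = \<phi> ` G"
    and G': "G' face_of W" "G' \<noteq> {}" "?D = \<psi> ` G'"
    by (metis cell_face_chart)
  have "G = G'"
    using emb_label[OF assms(1) G(1,2)] emb_label[OF assms(2) G'(1,2)] G(3) G'(3) by simp
  then have \<psi>G: "\<psi> ` G = \<phi> ` G"
    using G(3) G'(3) by simp
  have conv: "convex G" and comp: "compact G"
    using G convex_W compact_W by (auto intro: face_of_imp_convex face_of_imp_compact)
  \<comment> \<open>The transition map between the two charts of the common face, a self-isometry of
    \<open>G\<close>; the aim is to show that it is the identity.\<close>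
  define h where "h = inv_into G \<psi> \<circ> \<phi>"
  have hG: "h x \<in> G" and \<psi>h: "\<psi> (h x) = \<phi> x" if "x \<in> G" for x
    using that \<psi>G unfolding h_def by (auto intro!: inv_into_into f_inv_into_f)
  have iso: "dist (h x) (h y) = dist x y" if "x \<in> G" "y \<in> G" for x y
    using that \<psi>h emb_isometry[OF assms(2), of "h x" "h y"] emb_isometry[OF assms(1), of x y]
    by simp
  have himg: "h ` G = G"
  proof
    show "G \<subseteq> h ` G"
    proof
      fix w assume "w \<in> G"
      then obtain x where x: "x \<in> G" "\<phi> x = \<psi> w"
        using \<psi>G by (metis imageE imageI)
      then have "h x = w"
        using \<psi>h[of x] emb_eq_iff[OF assms(2)] by simp
      with x show "w \<in> h ` G"
        by auto
    qed
  qed (use hG in auto)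
  have "h v = v" if v: "v extreme_point_of G" for v
  proof -
    have "{v} face_of G"
      using v by (simp add: face_of_singleton)
    moreover from this have "{h v} face_of G"
      using isometric_image_face[OF iso conv, of "{v}"] himg by simp
    ultimately have "{v} face_of W" "{h v} face_of W"
      using G(1) face_of_trans by blast+
    moreover have "\<psi> ` {h v} = \<phi> ` {v}"
      using \<psi>h v by (simp add: extreme_point_of_def)
    ultimately have "{v} = {h v}"
      using emb_label[OF assms(1), of "{v}"] emb_label[OF assms(2), of "{h v}"] by simp
    then show ?thesis
      by simp
  qed
  then have "h x = x" if "x \<in> G" for x
    using isometric_fixes_hull[OF iso conv, of "{v. v extreme_point_of G}" x]
      Krein_Milman_Minkowski[OF comp conv] that by (auto simp: extreme_point_of_def)
  then show ?thesis
    using that G \<psi>h by metis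
qed

text \<open>The common point lies in a face on which the two charts agree. This makes the type of a
  point well defined.\<close>

lemma emb_type_unique:
  assumes "emb \<phi>" "emb \<psi>" "v \<in> W" "w \<in> W" "\<phi> v = \<psi> w"
  shows "v = w"
proof -
  have "\<phi> v \<in> \<phi> ` W \<inter> \<psi> ` W"
    using imageI[OF assms(3), of \<phi>] imageI[OF assms(4), of \<psi>] assms(5) by simp
  moreover from this have "\<phi> ` W \<inter> \<psi> ` W \<noteq> {}"
    by auto
  then obtain G where G: "\<phi> ` W \<inter> \<psi> ` W = \<phi> ` G" "\<forall>x\<in>G. \<phi> x = \<psi> x"
    using emb_Int[OF assms(1,2)] by metis
  ultimately have "\<phi> v \<in> \<phi> ` G"
    by metis
  then have "v \<in> G"
    by (metis imageE emb_eq_iff[OF assms(1)])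
  then show ?thesis
    using G(2) assms(5) emb_eq_iff[OF assms(2)] by metis
qed

text \<open>A face of \<open>W\<close> that meets the interior is \<open>W\<close> itself, so here
  the face of agreement is the whole chamber.\<close>

lemma emb_eq_on_W:
  assumes "emb \<phi>" "emb \<psi>" "v \<in> interior W" "w \<in> W" "\<phi> v = \<psi> w" "x \<in> W"
  shows "\<phi> x = \<psi> x"
proof -
  have v: "v \<in> W"
    using assms(3) interior_subset by auto
  then have "\<phi> v \<in> \<phi> ` W \<inter> \<psi> ` W"
    using imageI[OF v, of \<phi>] imageI[OF assms(4), of \<psi>] assms(5) by simp
  moreover from this have "\<phi> ` W \<inter> \<psi> ` W \<noteq> {}"
    by auto
  then obtain G where G: "G face_of W" "\<phi> ` W \<inter> \<psi> ` W = \<phi> ` G"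
      "\<forall>x\<in>G. \<phi> x = \<psi> x"
    using emb_Int[OF assms(1,2)] by metis
  ultimately have "\<phi> v \<in> \<phi> ` G"
    by metis
  then have "v \<in> G"
    by (metis imageE emb_eq_iff[OF assms(1)])
  then have "G = W"
    using face_of_disjoint_interior[OF G(1)] assms(3) by auto
  then show ?thesis
    using G assms by auto
qed

section \<open>Translates of the chamber\<close>

text \<open>An interior base point: by \<open>coxeter_orbit_separated\<close>, distinct group
  elements move it to distinct points, so group elements can be counted as points of space.\<close>

definition w0 :: "real^'n" where "w0 = (SOME w. w \<in> interior W)"

lemma w0: "w0 \<in> interior W"
  unfolding w0_def using interior_W by (simp add: some_in_eq)

lemma w0_W: "w0 \<in> W"
  using w0 interior_subset by auto

text \<open>This radius returns as a lower bound for the distance between points of the orbit of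
  \<open>w0\<close>, and hence for the length of nonzero translations in the group.\<close>

definition r0 :: real where "r0 = (SOME r. 0 < r \<and> ball w0 r \<subseteq> W)"

lemma r0: "0 < r0" "ball w0 r0 \<subseteq> W"
  using someI_ex[of "\<lambda>r. 0 < r \<and> ball w0 r \<subseteq> W"] w0 unfolding mem_interior r0_def by auto

lemma ball_r0_interior: "ball w0 r0 \<subseteq> interior W"
  using r0 by (simp add: interior_maximal)

text \<open>The charts \<open>\<phi>\<close> and \<open>\<phi> \<circ> g\<close> agree at an
  interior point, hence on \<open>W\<close>, so \<open>g\<close> fixes \<open>W\<close> pointwise by
  injectivity of \<open>\<phi>\<close>. An isometry that fixes a ball pointwise is the
  identity.\<close>

lemma emb_fixed_interior_imp_id:
  assumes "emb \<phi>" "v \<in> interior W" "w \<in> W" "g \<in> coxeter_group W" "g w = v"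
  shows "g = id"
proof -
  have "emb (\<phi> \<circ> g)"
    using assms emb_comp by simp
  then have *: "\<phi> x = \<phi> (g x)" if "x \<in> W" for x
    using emb_eq_on_W[OF assms(1) _ assms(2,3) _ that] assms(5) by simp
  then have gW: "g x = x" if "x \<in> W" for x
    using that emb_eq_iff[OF assms(1)] by metis
  have "g x = x" for x
  proof -
    define A where "A = linear_part g"
    have A: "linear A"
      using linear_part_isometry[of g] coxeter_group_isometry[OF assms(4)]
      by (simp add: A_def orthogonal_transformation_def)
    have gA: "g y = A y + g 0" for y
      by (simp add: A_def linear_part_def)
    define v where "v = x - w0"
    \<comment> \<open>Scales the direction into the ball of radius \<open>r0\<close>; the summand 1
      keeps the denominator positive when \<open>v = 0\<close>.\<close>
    define t where "t = r0 / (2 * (norm v + 1))"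
    have t: "t > 0"
      using r0(1) by (simp add: t_def add_nonneg_pos)
    have "norm (t *\<^sub>R v) < r0"
    proof -
      have "t * norm v \<le> t * (norm v + 1)"
        using t by simp
      also have "\<dots> = r0 / 2"
        by (simp add: t_def divide_simps add_nonneg_eq_0_iff)
      finally show ?thesis
        using r0(1) t by simp
    qed
    then have "w0 + t *\<^sub>R v \<in> ball w0 r0"
      by (simp add: dist_norm)
    then have "g (w0 + t *\<^sub>R v) = w0 + t *\<^sub>R v" "g w0 = w0"
      using gW r0(2) w0_W by auto
    then have "t *\<^sub>R A v = t *\<^sub>R v"
      unfolding gA[of "w0 + _"] gA[of w0] linear_add[OF A] linear_scale[OF A]
      by (metis (no_types, opaque_lifting) add.assoc add.commute add_left_cancel)
    then have "A v = v"
      using t by simp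
    then show ?thesis
      using \<open>g w0 = w0\<close> gA[of x] gA[of w0]
      by (simp add: v_def linear_diff[OF A] algebra_simps)
        (metis add.assoc add.commute add_left_cancel)
  qed
  then show ?thesis
    by auto
qed

lemma interior_fixed_imp_id:
  assumes "v \<in> interior W" "w \<in> W" "g \<in> coxeter_group W" "g w = v"
  shows "g = id"
  using common_apartment emb_fixed_interior_imp_id[OF _ assms] by metis

section \<open>Discreteness of the Coxeter group and covering by its chambers\<close>

text \<open>If the two points were closer, the inverse of \<open>g\<close> composed with
  \<open>h\<close> would move \<open>w0\<close> into the ball around \<open>w0\<close> and so be the
  identity.\<close>

lemma coxeter_orbit_separated:
  assumes "g \<in> coxeter_group W" "h \<in> coxeter_group W" "g \<noteq> h"
  shows "r0 \<le> dist (g w0) (h w0)"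
proof (rule ccontr)
  assume *: "\<not> ?thesis"
  obtain k where k: "k \<in> coxeter_group W" "\<And>x. g (k x) = x" "\<And>x. k (g x) = x"
    using assms(1) coxeter_group_inverse by blast
  have "dist w0 (k (h w0)) < r0"
    using * coxeter_group_isometry[OF k(1), of "g w0" "h w0"] k by simp
  then have "(k \<circ> h) w0 \<in> interior W"
    using ball_r0_interior by auto
  then have "k \<circ> h = id"
    using interior_fixed_imp_id[OF _ w0_W coxeter_group_comp[OF k(1) assms(2)]] by blast
  then have "g = h"
    using k(2) by (metis comp_apply eq_id_iff ext)
  with assms show False
    by simp
qed

lemma finite_coxeter_bounded: "finite {g \<in> coxeter_group W. dist p (g w0) \<le> R}"
proof -
  let ?S = "{g \<in> coxeter_group W. dist p (g w0) \<le> R}"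
  have "finite ((\<lambda>g. g w0) ` ?S)"
  proof (rule bounded_separated_imp_finite[OF _ r0(1)])
    show "bounded ((\<lambda>g. g w0) ` ?S)"
      by (rule bounded_subset[of "cball p R"]) auto
  qed (use coxeter_orbit_separated in auto)
  moreover have "inj_on (\<lambda>g. g w0) ?S"
    using coxeter_orbit_separated r0(1) by (fastforce intro!: inj_onI)
  ultimately show ?thesis
    using finite_imageD by blast
qed

lemma coxeter_covers:
  obtains g w where "g \<in> coxeter_group W" "w \<in> W" "p = g w"
proof -
  \<comment> \<open>The cutoff leaves finitely many candidates, and \<open>id\<close> is one of
    them, so a minimum exists.\<close>
  let ?S = "{g \<in> coxeter_group W. dist p (g w0) \<le> dist p w0}"
  have "id \<in> ?S"
    by (simp add: coxeter_group_id)
  then obtain g where g: "g \<in> ?S" "\<And>h. h \<in> ?S \<Longrightarrow> dist p (g w0) \<le> dist p (h w0)"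
    using finite_coxeter_bounded[of p "dist p w0"]
      arg_min_if_finite(1)[of ?S "\<lambda>g. dist p (g w0)"]
      arg_min_least[of ?S _ "\<lambda>g. dist p (g w0)"] by blast
  obtain k where k: "k \<in> coxeter_group W" "\<And>x. g (k x) = x" "\<And>x. k (g x) = x"
    using g(1) coxeter_group_inverse by blast
  have "k p \<in> W"
  proof (rule ccontr)
    assume "k p \<notin> W"
    then obtain F u b where F: "F facet_of W" "supports_at W F u b" "b < u \<bullet> k p"
      using polytope_facet_normal polytope_W interior_W by metis
    have u: "norm u = 1" "\<And>x. x \<in> W \<Longrightarrow> u \<bullet> x \<le> b"
      using F(2) by (auto simp: supports_at_def)
    have "u \<bullet> w0 \<noteq> b"
    proof
      assume eq: "u \<bullet> w0 = b"
      have "w0 + (r0 / 2) *\<^sub>R u \<in> ball w0 r0"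
        using r0(1) u(1) by (simp add: dist_norm)
      then have "u \<bullet> (w0 + (r0 / 2) *\<^sub>R u) \<le> b"
        using r0(2) u(2) by auto
      then show False
        using eq r0(1) u(1) by (simp add: inner_add_right norm_eq_1)
    qed
    then have neg: "u \<bullet> w0 < b"
      using u(2)[OF w0_W] by simp
    let ?s = "reflection u b"
    have gs: "g \<circ> ?s \<in> coxeter_group W"
      using g F reflection_in_coxeter_group coxeter_group_comp by blast
    have "(dist (?s w0) (k p))\<^sup>2 < (dist w0 (k p))\<^sup>2"
      unfolding dist_reflection_sq[OF u(1)] using neg F(3) by (simp add: mult_less_0_iff)
    then have "dist (?s w0) (k p) < dist w0 (k p)"
      by (simp add: power2_less_imp_less)
    then have "dist p (g (?s w0)) < dist p (g w0)"
      using g(1) coxeter_group_isometry[of g W "?s w0" "k p"] coxeter_group_isometry[of g W w0 "k p"] k(2)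
      by (simp add: dist_commute)
    then show False
      using g(1) g(2)[of "g \<circ> ?s"] gs by fastforce
  qed
  then show ?thesis
    using that[of g "k p"] g(1) k(2) by simp
qed

section \<open>Finiteness of the linear parts\<close>

text \<open>The unit normals of all walls, not only those of the facets of \<open>W\<close>.
  Conjugation permutes the reflections of the group, so its linear parts preserve this set.\<close>

definition normals :: "(real^'n) set" where
  "normals = {u. norm u = 1 \<and> (\<exists>b. reflection u b \<in> coxeter_group W)}"

lemma finite_coxeter_adjacent: "finite {g \<in> coxeter_group W. \<exists>w\<in>W. g w \<in> W}"
proof -
  let ?D = "diameter W"
  have D: "dist x y \<le> ?D" if "x \<in> W" "y \<in> W" for x y
    using that diameter_bounded_bound[OF compact_imp_bounded[OF compact_W]] by blast
  have "dist w0 (g w0) \<le> ?D + ?D" if "g \<in> coxeter_group W" "w \<in> W" "g w \<in> W" for g w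
  proof -
    have "dist w0 (g w0) \<le> dist w0 (g w) + dist (g w) (g w0)"
      by (rule dist_triangle)
    also have "\<dots> \<le> ?D + ?D"
      unfolding coxeter_group_isometry[OF that(1)] using D that w0_W by (intro add_mono) auto
    finally show ?thesis .
  qed
  then show ?thesis
    by (intro finite_subset[OF _ finite_coxeter_bounded[of w0 "?D + ?D"]]) auto
qed

text \<open>Two non-parallel walls meet in a point, which may be moved into \<open>W\<close>. So the angle between
  them already occurs in one of the finitely many stabilisers of points of \<open>W\<close>, and the unit
  normals are uniformly separated on the unit sphere.\<close>

lemma finite_normals: "finite normals"
proof -
  define S where "S = {g \<in> coxeter_group W. \<exists>w\<in>W. g w \<in> W}"
  define U where "U = {u :: real^'n. norm u = 1 \<and> (\<exists>b. reflection u b \<in> S)}"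
  \<comment> \<open>The value -1 accounts for \<open>u = - v\<close>. The restriction to values
    below 1 gives \<open>Max Q < 1\<close>, and the squared distance of unit vectors is
    \<open>2 - 2 * (u \<bullet> v)\<close>, so distinct normals stay apart.\<close>
  define Q where "Q = insert (-1) {q \<in> (\<lambda>(u, v). u \<bullet> v) ` (U \<times> U). q < 1}"
  have "finite {u :: real^'n. norm u = 1 \<and> (\<exists>b. reflection u b = s)}" for s
  proof (cases "\<exists>v b. norm v = 1 \<and> reflection v b = s")
    case True
    then obtain v b where "norm v = 1" "reflection v b = s"
      by blast
    then have "u \<in> {v, - v}" if "norm u = 1" "reflection u c = s" for u c
      using reflection_eq_imp[of u v c b] that by simp
    then have "{u. norm u = 1 \<and> (\<exists>b. reflection u b = s)} \<subseteq> {v, - v}"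
      by blast
    then show ?thesis
      by (rule finite_subset) simp
  next
    case False
    then have "{u. norm u = 1 \<and> (\<exists>b. reflection u b = s)} = {}"
      by blast
    then show ?thesis
      by (metis finite.emptyI)
  qed
  moreover have "U = (\<Union>s\<in>S. {u. norm u = 1 \<and> (\<exists>b. reflection u b = s)})"
    by (auto simp: U_def)
  ultimately have "finite U"
    using finite_coxeter_adjacent by (simp add: S_def)
  then have Q: "finite Q" "Q \<noteq> {}"
    by (auto simp: Q_def)
  have UQ: "u \<bullet> v \<in> Q" if u: "u \<in> normals" and v: "v \<in> normals" and "u \<noteq> v" for u v
  proof (cases "u = - v")
    case True
    then show ?thesis
      using v by (simp add: Q_def normals_def norm_eq_1)
  next
    case False
    obtain b c where b: "reflection u b \<in> coxeter_group W" "norm u = 1"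
      and c: "reflection v c \<in> coxeter_group W" "norm v = 1"
      using u v by (auto simp: normals_def)
    obtain x where x: "u \<bullet> x = b" "v \<bullet> x = c"
      using two_hyperplanes_meet[OF b(2) c(2) \<open>u \<noteq> v\<close> False] by blast
    obtain h w where h: "h \<in> coxeter_group W" "w \<in> W" "x = h w"
      using coxeter_covers by blast
    obtain g where g: "g \<in> coxeter_group W" "\<And>y. h (g y) = y" "\<And>y. g (h y) = y"
      using coxeter_group_inverse[OF h(1)] by blast
    let ?A = "linear_part g"
    have A: "orthogonal_transformation ?A"
      using coxeter_group_isometry[OF g(1)] by (rule linear_part_isometry)
    \<comment> \<open>Conjugation by \<open>g\<close> turns a wall through \<open>x\<close> into a
      wall through \<open>w\<close>; the conjugate reflection fixes \<open>w\<close> and hence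
      belongs to \<open>S\<close>.\<close>
    have mem: "?A n \<in> U" if n: "norm n = 1" "reflection n d \<in> coxeter_group W" "n \<bullet> x = d" for n d
    proof -
      let ?r = "reflection (?A n) (d + ?A n \<bullet> g 0)"
      have "?r y = (g \<circ> reflection n d \<circ> h) y" for y
        using isometry_conj_reflection[OF coxeter_group_isometry[OF g(1)], of n d "h y"] g(3) by simp
      then have r: "?r = g \<circ> reflection n d \<circ> h"
        by (rule ext)
      then have "?r \<in> coxeter_group W"
        using coxeter_group_comp g(1) h(1) n(2) by metis
      moreover have "?r w = w"
        unfolding r using n(3) h(3) g(3) by (simp add: reflection_def)
      ultimately have "?r \<in> S"
        unfolding S_def using h(2) by (metis (mono_tags, lifting) mem_Collect_eq)
      then show ?thesis
        using n(1) A unfolding U_def by (auto simp: orthogonal_transformation)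
    qed
    have "?A u \<bullet> ?A v = u \<bullet> v"
      using A by (simp add: orthogonal_transformation_def)
    moreover have "?A u \<in> U" "?A v \<in> U"
      using mem b c x by blast+
    moreover have "u \<bullet> v < 1"
    proof -
      have "0 < (u - v) \<bullet> (u - v)"
        using \<open>u \<noteq> v\<close> by simp
      then show ?thesis
        using b(2) c(2) by (simp add: inner_diff_left inner_diff_right inner_commute norm_eq_1)
    qed
    ultimately show ?thesis
      unfolding Q_def by (intro insertI2 CollectI conjI image_eqI[of _ _ "(?A u, ?A v)"]) auto
  qed
  have "Max Q < 1"
    using Q by (auto simp: Q_def)
  show ?thesis
  proof (rule bounded_separated_imp_finite)
    show "bounded normals"
      by (rule boundedI[of _ 1]) (simp add: normals_def)
    show "0 < sqrt (2 - 2 * Max Q)"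
      using \<open>Max Q < 1\<close> by simp
    fix u v assume uv: "u \<in> normals" "v \<in> normals" "u \<noteq> v"
    have "u \<bullet> v \<le> Max Q"
      using UQ[OF uv] Q by simp
    moreover have "(dist u v)\<^sup>2 = 2 - 2 * (u \<bullet> v)"
      using uv unfolding dist_norm power2_norm_eq_inner
      by (simp add: normals_def norm_eq_1 inner_diff_left inner_diff_right inner_commute)
    ultimately show "sqrt (2 - 2 * Max Q) \<le> dist u v"
      by (intro real_le_lsqrt) auto
  qed
qed

text \<open>Along a vector orthogonal to all normals no facet inequality of \<open>W\<close> ever
  changes, so the ray from \<open>w0\<close> in that direction would stay in the bounded set
  \<open>W\<close>.\<close>

lemma span_normals: "span normals = UNIV"
proof (rule ccontr)
  assume "span normals \<noteq> UNIV"
  then obtain x where x: "x \<noteq> 0" "\<And>u. u \<in> span normals \<Longrightarrow> x \<bullet> u = 0"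
    using span_not_UNIV_orthogonal by blast
  obtain M where M: "\<And>w. w \<in> W \<Longrightarrow> norm w \<le> M"
    using compact_imp_bounded[OF compact_W] by (auto simp: bounded_iff)
  define p where "p = w0 + ((M + norm w0 + 1) / norm x) *\<^sub>R x"
  have "0 \<le> M"
    using M[OF w0_W] norm_ge_zero order_trans by blast
  then have "norm (((M + norm w0 + 1) / norm x) *\<^sub>R x) = M + norm w0 + 1"
    using x(1) by simp
  then have "M < norm p"
    using norm_diff_ineq[of "((M + norm w0 + 1) / norm x) *\<^sub>R x" w0]
    by (simp add: p_def add.commute)
  then have "p \<notin> W"
    using M by fastforce
  then obtain F u b where F: "F facet_of W" "supports_at W F u b" "b < u \<bullet> p"
    using polytope_facet_normal polytope_W interior_W by metis
  then have "u \<in> normals"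
    using reflection_in_coxeter_group by (auto simp: normals_def supports_at_def)
  then have "u \<bullet> x = 0"
    using x(2) by (simp add: span_base inner_commute)
  then have "u \<bullet> p = u \<bullet> w0"
    by (simp add: p_def inner_add_right)
  then show False
    using F w0_W by (auto simp: supports_at_def)
qed

text \<open>A linear part maps the finite set \<open>normals\<close> into itself and is determined
  by its restriction there, because \<open>normals\<close> spans.\<close>

lemma finite_linear_parts: "finite (linear_part ` coxeter_group W)"
proof -
  let ?f = "\<lambda>A. restrict A normals"
  have "?f (linear_part g) \<in> normals \<rightarrow>\<^sub>E normals" if g: "g \<in> coxeter_group W" for g
  proof (rule restrict_PiE_iff[THEN iffD2], rule ballI)
    fix u assume "u \<in> normals"
    then obtain b where b: "norm u = 1" "reflection u b \<in> coxeter_group W"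
      by (auto simp: normals_def)
    obtain h where h: "h \<in> coxeter_group W" "\<And>x. g (h x) = x" "\<And>x. h (g x) = x"
      using coxeter_group_inverse[OF g] by blast
    have "reflection (linear_part g u) (b + linear_part g u \<bullet> g 0) y = (g \<circ> reflection u b \<circ> h) y" for y
      using isometry_conj_reflection[OF coxeter_group_isometry[OF g], of u b "h y"] h(2) by simp
    then have "reflection (linear_part g u) (b + linear_part g u \<bullet> g 0) = g \<circ> reflection u b \<circ> h"
      by (rule ext)
    then have "reflection (linear_part g u) (b + linear_part g u \<bullet> g 0) \<in> coxeter_group W"
      using coxeter_group_comp g h(1) b(2) by metis
    moreover have "norm (linear_part g u) = 1"
      using linear_part_isometry[of g] coxeter_group_isometry[OF g] b(1)
      by (simp add: orthogonal_transformation)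
    ultimately show "linear_part g u \<in> normals"
      by (auto simp: normals_def)
  qed
  then have "?f ` linear_part ` coxeter_group W \<subseteq> normals \<rightarrow>\<^sub>E normals"
    by blast
  then have "finite (?f ` linear_part ` coxeter_group W)"
    using finite_PiE[OF finite_normals, of "\<lambda>_. normals"] finite_normals finite_subset by blast
  moreover have "inj_on ?f (linear_part ` coxeter_group W)"
  proof (rule inj_onI, clarify)
    fix g h assume gh: "g \<in> coxeter_group W" "h \<in> coxeter_group W"
      "?f (linear_part g) = ?f (linear_part h)"
    have lin: "linear (linear_part g)" "linear (linear_part h)"
      using linear_part_isometry[OF coxeter_group_isometry[OF gh(1)]]
        linear_part_isometry[OF coxeter_group_isometry[OF gh(2)]]
      by (auto simp: orthogonal_transformation_def)
    have "linear_part g u = linear_part h u" if "u \<in> normals" for u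
      using gh(3) that by (metis restrict_apply')
    then have "linear_part g x = linear_part h x" for x
      using linear_eq_on_span[OF lin, of normals x] span_normals by blast
    then show "linear_part g = linear_part h"
      by (rule ext)
  qed
  ultimately show ?thesis
    using finite_imageD by blast
qed

section \<open>Types of midpoints\<close>

text \<open>The element \<open>a'\<close> composed with the inverse of \<open>a\<close> has trivial
  linear part.\<close>

lemma coxeter_translation:
  assumes "a \<in> coxeter_group W" "a' \<in> coxeter_group W" "linear_part a = linear_part a'"
  shows "(\<lambda>x. x + (a' 0 - a 0)) \<in> coxeter_group W"
proof -
  obtain k where k: "k \<in> coxeter_group W" "\<And>x. a (k x) = x" "\<And>x. k (a x) = x"
    using coxeter_group_inverse[OF assms(1)] by blast
  have "(a' \<circ> k) x = x + (a' 0 - a 0)" for x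
    using fun_cong[OF assms(3), of "k x"] k(2)[of x] by (simp add: linear_part_def algebra_simps)
  then show ?thesis
    using coxeter_group_comp[OF assms(2) k(1)] by (metis ext)
qed

text \<open>For fixed linear parts, two such sums differ by the translation vector of a group
  element, which has length at least \<open>r0\<close> unless it is 0. Sums are counted because the
  two summands may be large and cancel.\<close>

lemma finite_translation_sums:
  "finite {a 0 + b 0 | a b. a \<in> coxeter_group W \<and> b \<in> coxeter_group W \<and>
    linear_part a = A \<and> linear_part b = B \<and> norm (a 0 + b 0) \<le> R}" (is "finite ?T")
proof (rule bounded_separated_imp_finite[OF _ r0(1)])
  show "bounded ?T"
    by (rule boundedI[of _ R]) auto
  fix s s' assume "s \<in> ?T" "s' \<in> ?T" "s \<noteq> s'"
  then obtain a b a' b' where ab: "s = a 0 + b 0" "s' = a' 0 + b' 0"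
      "a \<in> coxeter_group W" "b \<in> coxeter_group W" "a' \<in> coxeter_group W" "b' \<in> coxeter_group W"
      "linear_part a = linear_part a'" "linear_part b = linear_part b'"
    by auto
  let ?t = "(\<lambda>x. x + (a' 0 - a 0)) \<circ> (\<lambda>x. x + (b' 0 - b 0))"
  have t: "?t x = x + (s' - s)" for x
    by (simp add: ab algebra_simps)
  have "?t \<in> coxeter_group W"
    using ab by (intro coxeter_group_comp coxeter_translation) auto
  moreover have "?t \<noteq> id"
    using \<open>s \<noteq> s'\<close> t[of 0] by (metis add_0 eq_iff_diff_eq_0 id_apply)
  ultimately have "r0 \<le> dist (?t w0) (id w0)"
    using coxeter_group_id by (intro coxeter_orbit_separated)
  then show "r0 \<le> dist s s'"
    unfolding t by (simp add: dist_norm norm_minus_commute)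
qed

definition midpoint_types :: "real^'n \<Rightarrow> real^'n \<Rightarrow> (real^'n) set" where
  "midpoint_types p q =
    {w \<in> W. \<exists>a\<in>coxeter_group W. \<exists>b\<in>coxeter_group W. w = (1/2) *\<^sub>R (a p + b q)}"

text \<open>If \<open>(a p + b q) / 2\<close> lies in \<open>W\<close>, then the sum of the translation parts of \<open>a\<close> and \<open>b\<close> is
  bounded, so it takes finitely many values for each of the finitely many pairs of linear parts.\<close>

lemma midpoint_types_bounded:
  obtains K where "\<And>p q. p \<in> W \<Longrightarrow> q \<in> W \<Longrightarrow> finite (midpoint_types p q)"
    "\<And>p q. p \<in> W \<Longrightarrow> q \<in> W \<Longrightarrow> card (midpoint_types p q) \<le> K"
proof -
  obtain M where M: "\<And>w. w \<in> W \<Longrightarrow> norm w \<le> M"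
    using compact_imp_bounded[OF compact_W] by (auto simp: bounded_iff)
  define L where "L = linear_part ` coxeter_group W"
  \<comment> \<open>The bound \<open>4 * M\<close> comes from writing the sum of translation parts
    as \<open>w + w - ?A p - ?B q\<close>, four vectors of norm at most \<open>M\<close>.\<close>
  define T where "T A B = {a 0 + b 0 | a b. a \<in> coxeter_group W \<and> b \<in> coxeter_group W \<and>
    linear_part a = A \<and> linear_part b = B \<and> norm (a 0 + b 0) \<le> 4 * M}" for A B
  define D where "D = (SIGMA A:L. SIGMA B:L. T A B)"
  have D: "finite D"
    unfolding D_def T_def L_def using finite_linear_parts finite_translation_sums
    by (intro finite_SigmaI) auto
  have sub: "midpoint_types p q \<subseteq> (\<lambda>(A, B, s). (1/2) *\<^sub>R (A p + B q + s)) ` D"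
    if "p \<in> W" "q \<in> W" for p q
  proof
    fix w assume "w \<in> midpoint_types p q"
    then obtain a b where w: "w \<in> W" "a \<in> coxeter_group W" "b \<in> coxeter_group W"
        "w = (1/2) *\<^sub>R (a p + b q)"
      by (auto simp: midpoint_types_def)
    let ?A = "linear_part a" and ?B = "linear_part b"
    have ab: "a p = ?A p + a 0" "b q = ?B q + b 0"
      by (simp_all add: linear_part_def)
    have nrm: "norm (?A p) = norm p" "norm (?B q) = norm q"
      using linear_part_isometry coxeter_group_isometry w(2,3)
      by (metis orthogonal_transformation)+
    have "a 0 + b 0 = w + w - ?A p - ?B q"
      using w(4) ab by (simp flip: scaleR_2)
    then have "norm (a 0 + b 0) \<le> norm w + norm w + norm p + norm q"
      using norm_triangle_ineq4[of "w + w - ?A p" "?B q"] norm_triangle_ineq4[of "w + w" "?A p"]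
        norm_triangle_ineq[of w w] nrm by simp
    also have "\<dots> \<le> 4 * M"
      using M[OF w(1)] M[OF that(1)] M[OF that(2)] by simp
    finally have "(?A, ?B, a 0 + b 0) \<in> D"
      using w by (auto simp: D_def L_def T_def)
    moreover have "w = (1/2) *\<^sub>R (?A p + ?B q + (a 0 + b 0))"
      unfolding w(4) ab by (simp add: algebra_simps)
    ultimately show "w \<in> (\<lambda>(A, B, s). (1/2) *\<^sub>R (A p + B q + s)) ` D"
      by (force intro: rev_image_eqI)
  qed
  have "card (midpoint_types p q) \<le> card D" if "p \<in> W" "q \<in> W" for p q
    using card_mono[OF _ sub[OF that]] card_image_le[OF D] D by (meson finite_imageI order_trans)
  moreover have "finite (midpoint_types p q)" if "p \<in> W" "q \<in> W" for p q
    using sub[OF that] D by (meson finite_imageI finite_subset)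
  ultimately show ?thesis
    by (rule that[rotated])
qed

section \<open>Types of points\<close>

text \<open>The graph of the canonical folding of the building onto its model chamber.\<close>

definition has_type :: "'x \<Rightarrow> real^'n \<Rightarrow> bool" where
  "has_type x w \<longleftrightarrow> w \<in> W \<and> (\<exists>\<phi>. emb \<phi> \<and> \<phi> w = x)"

lemma has_type_unique: "has_type x v \<Longrightarrow> has_type x w \<Longrightarrow> v = w"
  unfolding has_type_def using emb_type_unique by metis

lemma emb_has_type:
  assumes "emb \<phi>" "g \<in> coxeter_group W" "w \<in> W"
  shows "has_type (\<phi> (g w)) w"
  using emb_comp[OF assms(1,2)] assms(3) unfolding has_type_def by (metis comp_apply)

lemma has_type_exists: "\<exists>w. has_type x w"
proof -
  obtain \<phi> p q where "emb \<phi>" "x = \<phi> p"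
    by (rule common_apartment[of x x])
  moreover obtain g w where "g \<in> coxeter_group W" "w \<in> W" "p = g w"
    by (rule coxeter_covers)
  ultimately show ?thesis
    using emb_has_type by blast
qed

lemma has_type_in_apartment:
  assumes "emb \<phi>" "has_type (\<phi> p) w"
  obtains g where "g \<in> coxeter_group W" "p = g w"
proof -
  obtain g v where g: "g \<in> coxeter_group W" "v \<in> W" "p = g v"
    by (rule coxeter_covers)
  then have "v = w"
    using emb_has_type[OF assms(1)] assms(2) has_type_unique by metis
  with g that show ?thesis
    by blast
qed

text \<open>In a common apartment the two points lie in one Coxeter orbit, so their distance is the
  displacement of \<open>w\<close> under a group element. Only finitely many elements displace
  \<open>w\<close> by at most 1.\<close>

lemma has_type_separated:
  obtains d where "0 < d" "\<And>x y. has_type x w \<Longrightarrow> has_type y w \<Longrightarrow> x \<noteq> y \<Longrightarrow> d \<le> dist x y"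
proof -
  \<comment> \<open>An element displacing \<open>w\<close> by at most 1 displaces \<open>w0\<close>
    by at most this much: passing between \<open>w\<close> and \<open>w0\<close> costs
    \<open>dist w w0\<close> at either end.\<close>
  define S where "S = {g \<in> coxeter_group W. dist w0 (g w0) \<le> 1 + 2 * dist w w0}"
  \<comment> \<open>The element 1 covers pairs at distance above 1 and keeps the minimum defined
    when no displacement qualifies.\<close>
  define D where "D = insert 1 ((\<lambda>g. dist w (g w)) ` {g \<in> S. g w \<noteq> w})"
  have D: "finite D" "D \<noteq> {}"
  proof -
    have "finite S"
      unfolding S_def by (rule finite_coxeter_bounded)
    then have "finite {g \<in> S. g w \<noteq> w}"
      by (rule rev_finite_subset) blast
    then show "finite D" "D \<noteq> {}"
      by (auto simp: D_def)
  qed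
  have "0 < Min D"
    using D by (auto simp: D_def)
  moreover have "Min D \<le> dist x y" if xy: "has_type x w" "has_type y w" "x \<noteq> y" for x y
  proof -
    obtain \<phi> p q where \<phi>: "emb \<phi>" "x = \<phi> p" "y = \<phi> q"
      by (rule common_apartment)
    obtain g h where g: "g \<in> coxeter_group W" "p = g w" and h: "h \<in> coxeter_group W" "q = h w"
      using xy \<phi> has_type_in_apartment by metis
    obtain k where k: "k \<in> coxeter_group W" "\<And>z. g (k z) = z" "\<And>z. k (g z) = z"
      using coxeter_group_inverse[OF g(1)] by blast
    let ?f = "k \<circ> h"
    have f: "?f \<in> coxeter_group W"
      using k(1) h(1) by (rule coxeter_group_comp)
    have xyf: "dist x y = dist w (?f w)"
      using \<phi> emb_isometry[OF \<phi>(1)] coxeter_group_isometry[OF k(1), of p q] k(3) g(2) h(2)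
      by simp
    have "Min D \<le> 1"
      using D by (simp add: D_def)
    show ?thesis
    proof (cases "dist x y \<le> 1")
      case True
      have "dist w0 (?f w0) \<le> dist w0 w + dist w (?f w) + dist (?f w) (?f w0)"
        using dist_triangle[of w0 "?f w0" w] dist_triangle[of w "?f w0" "?f w"] by linarith
      also have "\<dots> \<le> 1 + 2 * dist w w0"
        unfolding coxeter_group_isometry[OF f] using True xyf by (simp add: dist_commute)
      finally have "?f \<in> S"
        using f by (simp add: S_def)
      moreover have "?f w \<noteq> w"
        using xyf xy(3) by auto
      ultimately have "dist x y \<in> D"
        unfolding D_def xyf by blast
      then show ?thesis
        using D by simp
    qed (use \<open>Min D \<le> 1\<close> in linarith)
  qed
  ultimately show ?thesis
    by (rule that)
qed

end

section \<open>Geodesics in CAT(0) spaces\<close>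

lemma CAT0_comparison:
  fixes c1 :: "real \<Rightarrow> 'a::metric_space" and P Q R S T :: "real^2"
  assumes "CAT0 TYPE('a)" "geodesic c1 l1" "geodesic c2 l2" "c1 0 = c2 0"
    "dist P Q = l1" "dist P R = l2" "dist Q R = dist (c1 l1) (c2 l2)"
    "s \<in> {0..l1}" "t \<in> {0..l2}" "S \<in> closed_segment P Q" "T \<in> closed_segment P R"
    "dist P S = s" "dist P T = t"
  shows "dist (c1 s) (c2 t) \<le> dist S T"
  using assms unfolding CAT0_def by blast

lemma scaled_in_segment:
  fixes P Q :: "'a::real_normed_vector"
  assumes "0 \<le> s" "s \<le> dist P Q" "P \<noteq> Q"
  shows "P + (s / dist P Q) *\<^sub>R (Q - P) \<in> closed_segment P Q"
    "dist P (P + (s / dist P Q) *\<^sub>R (Q - P)) = s"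
proof -
  have "P + (s / dist P Q) *\<^sub>R (Q - P) = (1 - s / dist P Q) *\<^sub>R P + (s / dist P Q) *\<^sub>R Q"
    by (simp add: algebra_simps)
  moreover have "0 \<le> s / dist P Q" "s / dist P Q \<le> 1"
    using assms by auto
  ultimately show "P + (s / dist P Q) *\<^sub>R (Q - P) \<in> closed_segment P Q"
    unfolding in_segment by blast
  have "norm (Q - P) = dist P Q"
    by (simp add: dist_norm norm_minus_commute)
  then show "dist P (P + (s / dist P Q) *\<^sub>R (Q - P)) = s"
    using assms by (simp add: dist_norm[of P "P + _"])
qed

text \<open>The comparison triangle degenerates to a doubled segment (\<open>R = Q\<close>), in
  which the two comparison points coincide.\<close>

lemma CAT0_geodesic_unique:
  fixes c1 c2 :: "real \<Rightarrow> 'a::metric_space"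
  assumes "CAT0 TYPE('a)" "geodesic c1 l" "geodesic c2 l" "c1 0 = c2 0" "c1 l = c2 l" "s \<in> {0..l}"
  shows "c1 s = c2 s"
proof (cases "l = 0")
  case False
  obtain Q :: "real^2" where Q: "dist 0 Q = l"
    using vector_choose_dist[of l 0] assms(6) by (metis atLeastAtMost_iff order_trans)
  then have "0 \<noteq> Q"
    using False by auto
  note S = scaled_in_segment[of s 0 Q, OF _ _ this]
  have "dist (c1 s) (c2 s) \<le> dist (0 + (s / dist 0 Q) *\<^sub>R (Q - 0)) (0 + (s / dist 0 Q) *\<^sub>R (Q - 0))"
    using assms Q S by (intro CAT0_comparison[OF assms(1-4) Q Q]) auto
  then show ?thesis
    by simp
qed (use assms in auto)

text \<open>Law of cosines: \<open>x\<close> is the coordinate of \<open>R\<close> along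
  \<open>Q\<close>, and the triangle inequalities give \<open>\<bar>x\<bar> \<le> m\<close>, so that
  \<open>y\<close> is a real square root.\<close>

lemma comparison_triangle:
  fixes a m d :: real
  assumes "0 < a" "0 \<le> m" "\<bar>a - m\<bar> \<le> d" "d \<le> a + m"
  obtains Q R :: "real^2" where "dist 0 Q = a" "dist 0 R = m" "dist Q R = d"
proof -
  define x where "x = (a\<^sup>2 + m\<^sup>2 - d\<^sup>2) / (2 * a)"
  define y where "y = sqrt (m\<^sup>2 - x\<^sup>2)"
  have "0 \<le> d"
    using assms by linarith
  have "d\<^sup>2 \<le> (a + m)\<^sup>2" "(a - m)\<^sup>2 \<le> d\<^sup>2"
    using assms \<open>0 \<le> d\<close> by (auto intro: power_mono simp: abs_le_square_iff[symmetric])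
  then have "- (2 * a * m) \<le> a\<^sup>2 + m\<^sup>2 - d\<^sup>2" "a\<^sup>2 + m\<^sup>2 - d\<^sup>2 \<le> 2 * a * m"
    by (simp_all add: power2_eq_square algebra_simps)
  then have "\<bar>x\<bar> \<le> m"
    using assms(1) unfolding x_def by (simp add: abs_le_iff divide_simps algebra_simps)
  then have "x\<^sup>2 \<le> m\<^sup>2"
    by (simp add: abs_le_square_iff[symmetric])
  then have y: "y\<^sup>2 = m\<^sup>2 - x\<^sup>2"
    by (simp add: y_def)
  define Q :: "real^2" where "Q = vector [a, 0]"
  define R :: "real^2" where "R = vector [x, y]"
  have nrm: "norm (v :: real^2) = sqrt ((v $ 1)\<^sup>2 + (v $ 2)\<^sup>2)" for v
    by (simp add: norm_vec_def L2_set_def sum_2)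
  have "dist 0 Q = a" "dist 0 R = m"
    using assms y by (simp_all add: nrm Q_def R_def)
  moreover have "(a - x)\<^sup>2 + y\<^sup>2 = d\<^sup>2"
    unfolding y using assms(1) by (simp add: x_def power2_eq_square field_simps)
  then have "dist Q R = d"
    using \<open>0 \<le> d\<close> by (simp add: nrm Q_def R_def dist_norm)
  ultimately show ?thesis
    by (rule that)
qed

text \<open>At \<open>c a\<close> the comparison points on the two sides are antipodal, so the comparison triangle of
  \<open>c 0\<close>, \<open>c a\<close>, \<open>c b\<close> is degenerate.\<close>

lemma CAT0_geodesic_extend:
  fixes c :: "real \<Rightarrow> 'a::metric_space"
  assumes cat: "CAT0 TYPE('a)" and c: "geodesic c a" and "a \<le> b" "0 < e" "e \<le> a"
    and loc: "\<And>r s. r \<in> {a..b} \<Longrightarrow> s \<in> {a..b} \<Longrightarrow> dist (c r) (c s) = \<bar>r - s\<bar>"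
    and straight: "\<And>s. 0 < s \<Longrightarrow> s \<le> e \<Longrightarrow> a + s \<le> b \<Longrightarrow> dist (c (a - s)) (c (a + s)) = 2 * s"
  shows "geodesic c b"
proof (cases "a = b")
  case False
  define m where "m = b - a"
  have m: "0 < m"
    using False assms(3) by (simp add: m_def)
  have ca: "dist (c r) (c s) = \<bar>r - s\<bar>" if "r \<in> {0..a}" "s \<in> {0..a}" for r s
    using c that by (simp add: geodesic_def)
  define d where "d = dist (c 0) (c b)"
  have d: "dist (c 0) (c a) = a" "dist (c a) (c b) = m"
    using ca[of 0 a] loc[of a b] assms m by (auto simp: m_def)
  have "d \<le> a + m" "\<bar>a - m\<bar> \<le> d"
    using d dist_triangle[of "c 0" "c b" "c a"] dist_triangle[of "c 0" "c a" "c b"]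
      dist_triangle[of "c a" "c b" "c 0"]
    by (auto simp: d_def dist_commute)
  then obtain Q R :: "real^2" where QR: "dist 0 Q = a" "dist 0 R = m" "dist Q R = d"
    using comparison_triangle[of a m d] assms m by auto
  then have nz: "0 \<noteq> Q" "0 \<noteq> R"
    using assms m by auto
  define s where "s = min e m"
  have s: "0 < s" "s \<le> e" "s \<le> m" "s \<le> a"
    using assms m by (auto simp: s_def)
  define S T where "S = (s / a) *\<^sub>R Q" and "T = (s / m) *\<^sub>R R"
  have S: "S \<in> closed_segment 0 Q" "dist 0 S = s" and T: "T \<in> closed_segment 0 R" "dist 0 T = s"
    using scaled_in_segment[of s 0 Q] scaled_in_segment[of s 0 R] s nz
    unfolding QR by (auto simp: S_def T_def)
  have g1: "geodesic (\<lambda>t. c (a - t)) a"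
    using assms by (auto simp: geodesic_def intro!: trans[OF ca])
  have g2: "geodesic (\<lambda>t. c (a + t)) m"
    using assms m by (auto simp: geodesic_def m_def intro!: trans[OF loc])
  have "dist (c (a - s)) (c (a + s)) \<le> dist S T"
    using CAT0_comparison[OF cat g1 g2 _ QR(1,2) _ _ _ S(1) T(1) S(2) T(2)] s QR(3)
    by (simp add: d_def m_def)
  moreover have "dist (c (a - s)) (c (a + s)) = 2 * s"
    using straight[of s] s by (simp add: m_def)
  ultimately have "(2 * s)\<^sup>2 \<le> (norm (S - T))\<^sup>2"
    using s by (intro power_mono) (auto simp: dist_norm)
  moreover have "norm S = s" "norm T = s"
    using S T by auto
  \<comment> \<open>Parallelogram law: two vectors of length \<open>s\<close> at distance at least
    \<open>2 * s\<close> have sum 0.\<close>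
  moreover have "(norm (S + T))\<^sup>2 + (norm (S - T))\<^sup>2 = 2 * (norm S)\<^sup>2 + 2 * (norm T)\<^sup>2"
    unfolding power2_norm_eq_inner
    by (simp add: inner_add_left inner_add_right inner_diff_left inner_diff_right inner_commute)
  ultimately have "(norm (S + T))\<^sup>2 < r" if "0 < r" for r
    using that by (simp add: power_mult_distrib)
  then have "\<not> 0 < (norm (S + T))\<^sup>2"
    by blast
  then have "T = - S"
    by (simp add: add_eq_0_iff)
  then have "R = - ((m / a) *\<^sub>R Q)"
  proof -
    have "R = (m / s) *\<^sub>R T"
      using s m by (simp add: T_def)
    also have "\<dots> = - ((m / a) *\<^sub>R Q)"
      unfolding \<open>T = - S\<close> using s by (simp add: S_def)
    finally show ?thesis .
  qed
  then have "Q - R = (1 + m / a) *\<^sub>R Q"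
    by (simp add: algebra_simps)
  then have "d = (1 + m / a) * a"
    using QR m assms(4,5) by (simp add: dist_norm)
  then have db: "dist (c 0) (c b) = b"
    using assms(4,5) by (simp add: d_def m_def field_simps)
  have main: "dist (c r) (c t) = t - r" if "0 \<le> r" "r \<le> a" "a \<le> t" "t \<le> b" for r t
  proof (rule antisym)
    show "dist (c r) (c t) \<le> t - r"
      using dist_triangle[of "c r" "c t" "c a"] ca[of r a] loc[of a t] that assms by simp
    \<comment> \<open>The outer pieces of the broken path have lengths \<open>r\<close> and
      \<open>b - t\<close>, so the middle one has length at least \<open>t - r\<close>.\<close>
    have "b \<le> dist (c 0) (c r) + dist (c r) (c t) + dist (c t) (c b)"
      using db dist_triangle[of "c 0" "c b" "c r"] dist_triangle[of "c r" "c b" "c t"] by linarith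
    then show "t - r \<le> dist (c r) (c t)"
      using ca[of 0 r] loc[of t b] that assms by simp
  qed
  have "dist (c r) (c t) = \<bar>r - t\<bar>" if "r \<in> {0..b}" "t \<in> {0..b}" for r t
  proof -
    consider "r \<le> a" "t \<le> a" | "r \<le> a" "a \<le> t" | "t \<le> a" "a \<le> r" | "a \<le> r" "a \<le> t"
      by linarith
    then show ?thesis
    proof cases
      case 1
      then show ?thesis using ca that by simp
    next
      case 2
      then show ?thesis using main[of r t] that by simp
    next
      case 3
      then show ?thesis using main[of t r] that by (simp add: dist_commute)
    next
      case 4
      then show ?thesis using loc that assms(4) by simp
    qed
  qed
  then show ?thesis
    using assms by (simp add: geodesic_def)
qed (use c in simp)

context coxeter_building
begin

text \<open>The straight segment in the apartment is a geodesic with the same ends, so uniqueness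
  forces \<open>c\<close> to follow it.\<close>

lemma geodesic_midpoint:
  assumes "geodesic c l" "emb \<phi>" "c 0 = \<phi> p" "c l = \<phi> q"
  shows "c (l / 2) = \<phi> ((1/2) *\<^sub>R (p + q))"
proof -
  have l: "0 \<le> l" "dist p q = l"
    using assms(1) emb_isometry[OF assms(2), of p q]
    unfolding assms(3,4)[symmetric] geodesic_def by force+
  define c' where "c' = (\<lambda>t. \<phi> (p + (t / l) *\<^sub>R (q - p)))"
  show ?thesis
  proof (cases "l = 0")
    case True
    then show ?thesis
      using assms(3) l by (simp flip: scaleR_2)
  next
    case False
    have "dist (c' s) (c' t) = \<bar>s - t\<bar>" for s t
    proof -
      have "dist (c' s) (c' t) = norm ((s / l) *\<^sub>R (q - p) - (t / l) *\<^sub>R (q - p))"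
        using emb_isometry[OF assms(2)] by (simp add: c'_def dist_norm)
      also have "\<dots> = norm (((s - t) / l) *\<^sub>R (q - p))"
        by (simp only: scaleR_diff_left[symmetric] diff_divide_distrib)
      also have "\<dots> = \<bar>s - t\<bar>"
        using False l by (simp add: dist_norm norm_minus_commute)
      finally show ?thesis .
    qed
    then have "geodesic c' l"
      using l by (simp add: geodesic_def)
    moreover have "c 0 = c' 0" "c l = c' l"
      using assms False by (auto simp: c'_def)
    moreover have "l / 2 \<in> {0..l}"
      using l by simp
    ultimately have "c (l / 2) = c' (l / 2)"
      by (rule CAT0_geodesic_unique[OF CAT0 assms(1)])
    moreover have "p + (l / 2 / l) *\<^sub>R (q - p) = (1/2) *\<^sub>R (p + q)"
      using False by (simp add: vec_eq_iff field_simps)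
    then have "c' (l / 2) = \<phi> ((1/2) *\<^sub>R (p + q))"
      by (simp only: c'_def)
    ultimately show ?thesis
      by simp
  qed
qed

lemma geodesic_midpoint_type:
  assumes "geodesic c l" "has_type (c 0) p" "has_type (c l) q"
  obtains w where "w \<in> midpoint_types p q" "has_type (c (l / 2)) w"
proof -
  obtain \<phi> p' q' where \<phi>: "emb \<phi>" "c 0 = \<phi> p'" "c l = \<phi> q'"
    by (rule common_apartment)
  obtain a b where a: "a \<in> coxeter_group W" "p' = a p" and b: "b \<in> coxeter_group W" "q' = b q"
    using has_type_in_apartment[OF \<phi>(1)] assms(2,3) \<phi>(2,3) by metis
  define m where "m = (1/2) *\<^sub>R (p' + q')"
  have m: "c (l / 2) = \<phi> m"
    unfolding m_def by (rule geodesic_midpoint[OF assms(1) \<phi>])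
  obtain h w where h: "h \<in> coxeter_group W" "w \<in> W" "m = h w"
    by (rule coxeter_covers)
  obtain k where k: "k \<in> coxeter_group W" "\<And>z. h (k z) = z" "\<And>z. k (h z) = z"
    using coxeter_group_inverse[OF h(1)] by blast
  \<comment> \<open>Moving the midpoint into \<open>W\<close> by \<open>k\<close> commutes with
    taking midpoints, because isometries are affine; \<open>k\<close> is then absorbed into
    \<open>a\<close> and \<open>b\<close>.\<close>
  have "w = k ((1 - 1/2) *\<^sub>R p' + (1/2) *\<^sub>R q')"
    using k(3)[of w] h(3) by (simp add: m_def scaleR_add_right)
  also have "\<dots> = (1 - 1/2) *\<^sub>R k p' + (1/2) *\<^sub>R k q'"
    by (rule isometric_on_convex_affine[of UNIV]) (auto simp: coxeter_group_isometry[OF k(1)])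
  finally have "w = (1/2) *\<^sub>R ((k \<circ> a) p + (k \<circ> b) q)"
    using a(2) b(2) by (simp add: scaleR_add_right)
  then have "w \<in> midpoint_types p q"
    unfolding midpoint_types_def using h(2) coxeter_group_comp[OF k(1)] a(1) b(1) by blast
  moreover have "has_type (c (l / 2)) w"
    unfolding m h(3) using \<phi>(1) h by (intro emb_has_type)
  ultimately show ?thesis
    by (rule that)
qed

end

section \<open>The deck group\<close>

lemma subgroup_building_isometries:
  "subgroup (carrier (building_isometries cells label)) isometry_group"
proof (rule group.subgroupI[OF group_isometry_group])
  show "carrier (building_isometries cells label) \<subseteq> carrier isometry_group"
    by (auto simp: building_isometries_def)
  have "id \<in> carrier (building_isometries cells label)"
    by (simp add: building_isometries_def isometry_group_def)
  then show "carrier (building_isometries cells label) \<noteq> {}"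
    by blast
next
  fix f assume f: "f \<in> carrier (building_isometries cells label)"
  let ?h = "inv\<^bsub>isometry_group\<^esub> f"
  have fi: "f \<in> carrier isometry_group" and fc: "(\<lambda>C. f ` C) ` cells = cells"
    and fl: "\<And>C. C \<in> cells \<Longrightarrow> label (f ` C) = label C"
    using f by (auto simp: building_isometries_def)
  have "f \<circ> ?h = id" "?h \<circ> f = id"
    using group.r_inv[OF group_isometry_group fi] group.l_inv[OF group_isometry_group fi]
    by (simp_all add: isometry_group_def)
  then have hf: "?h ` f ` C = C" for C
    by (simp add: image_comp)
  have "(\<lambda>C. ?h ` C) ` cells = (\<lambda>C. ?h ` C) ` (\<lambda>C. f ` C) ` cells"
    by (simp only: fc)
  also have "\<dots> = cells"
    by (simp add: image_image[of "\<lambda>C. ?h ` C"] hf)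
  finally have "(\<lambda>C. ?h ` C) ` cells = cells" .
  moreover have "label (?h ` C) = label C" if C: "C \<in> cells" for C
  proof -
    obtain D where "D \<in> cells" "C = f ` D"
      using fc C by blast
    then show ?thesis
      using fl hf by simp
  qed
  ultimately show "?h \<in> carrier (building_isometries cells label)"
    using group.inv_closed[OF group_isometry_group fi] by (simp add: building_isometries_def)
next
  fix f g assume f: "f \<in> carrier (building_isometries cells label)"
    and g: "g \<in> carrier (building_isometries cells label)"
  have "(\<lambda>C. (f \<circ> g) ` C) ` cells = (\<lambda>C. f ` C) ` (\<lambda>C. g ` C) ` cells"
    by (simp only: image_comp o_def)
  then have "(\<lambda>C. (f \<circ> g) ` C) ` cells = cells"
    using f g by (simp add: building_isometries_def)
  moreover have "label ((f \<circ> g) ` C) = label C" if "C \<in> cells" for C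
  proof -
    have "g ` C \<in> cells"
      using g that by (auto simp: building_isometries_def)
    then have "label (f ` g ` C) = label C"
      using f g that by (simp add: building_isometries_def)
    then show ?thesis
      by (simp only: image_comp)
  qed
  moreover have "f \<circ> g \<in> carrier isometry_group"
    using group.is_monoid[OF group_isometry_group, THEN monoid.m_closed, of f g] f g
    by (simp add: building_isometries_def isometry_group_def)
  ultimately have "f \<circ> g \<in> carrier (building_isometries cells label)"
    by (simp add: building_isometries_def)
  then show "f \<otimes>\<^bsub>isometry_group\<^esub> g \<in> carrier (building_isometries cells label)"
    by (simp add: isometry_group_def)
qed

lemma group_building_isometries: "group (building_isometries cells label)"
  using subgroup.subgroup_is_group[OF subgroup_building_isometries group_isometry_group, of cells label]
  by (simp add: building_isometries_def)

locale building_quotient = coxeter_building W cells label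
  for W :: "(real^'n) set"
    and cells :: "'x::metric_space set set"
    and label :: "'x set \<Rightarrow> (real^'n) set" +
  fixes \<Gamma> :: "('x \<Rightarrow> 'x) set"
  assumes quotient: "compact_quotient cells label \<Gamma>"
begin

abbreviation orb :: "'x \<Rightarrow> 'x set" where
  "orb x \<equiv> (\<lambda>g. g x) ` \<Gamma>"

lemma subgroup_\<Gamma>: "subgroup \<Gamma> (building_isometries cells label)"
  using quotient by (simp add: compact_quotient_def)

lemma \<Gamma>_building_isometry: "g \<in> \<Gamma> \<Longrightarrow> g \<in> carrier (building_isometries cells label)"
  using subgroup.subset[OF subgroup_\<Gamma>] by auto

lemma \<Gamma>_isometry: "g \<in> \<Gamma> \<Longrightarrow> dist (g x) (g y) = dist x y"
  using \<Gamma>_building_isometry[of g] by (simp add: building_isometries_def isometry_group_def)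

lemma \<Gamma>_id: "id \<in> \<Gamma>"
  using subgroup.one_closed[OF subgroup_\<Gamma>]
  by (simp add: building_isometries_def isometry_group_def)

lemma \<Gamma>_comp: "g \<in> \<Gamma> \<Longrightarrow> h \<in> \<Gamma> \<Longrightarrow> g \<circ> h \<in> \<Gamma>"
  using subgroup.m_closed[OF subgroup_\<Gamma>]
  by (simp add: building_isometries_def isometry_group_def)

lemma \<Gamma>_inverse:
  assumes "g \<in> \<Gamma>"
  obtains h where "h \<in> \<Gamma>" "\<And>x. g (h x) = x" "\<And>x. h (g x) = x"
proof
  let ?B = "building_isometries cells label"
  let ?h = "inv\<^bsub>?B\<^esub> g"
  show "?h \<in> \<Gamma>"
    using assms by (rule subgroup.m_inv_closed[OF subgroup_\<Gamma>])
  have "g \<circ> ?h = id" "?h \<circ> g = id"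
    using group.r_inv[OF group_building_isometries \<Gamma>_building_isometry[OF assms]]
      group.l_inv[OF group_building_isometries \<Gamma>_building_isometry[OF assms]]
    by (simp_all add: building_isometries_def isometry_group_def)
  then show "g (?h x) = x" "?h (g x) = x" for x
    by (metis comp_apply id_apply)+
qed

lemma emb_\<Gamma>:
  assumes "emb \<phi>" "g \<in> \<Gamma>"
  shows "emb (g \<circ> \<phi>)"
proof -
  have g: "g ` C \<in> cells" "label (g ` C) = label C" if "C \<in> cells" for C
    using \<Gamma>_building_isometry[OF assms(2)] that by (auto simp: building_isometries_def)
  have "(g \<circ> \<phi>) ` h ` F \<in> cells \<and> label ((g \<circ> \<phi>) ` h ` F) = F"
    if "h \<in> coxeter_group W" "F face_of W \<and> F \<noteq> {}" for h F
  proof -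
    have "\<phi> ` h ` F \<in> cells \<and> label (\<phi> ` h ` F) = F"
      using assms(1) that unfolding apartment_embedding_def by blast
    then show ?thesis
      using g unfolding image_comp[symmetric] by simp
  qed
  then show ?thesis
    using emb_isometry[OF assms(1)] \<Gamma>_isometry[OF assms(2)] by (simp add: apartment_embedding_def)
qed

lemma has_type_\<Gamma>: "has_type x w \<Longrightarrow> g \<in> \<Gamma> \<Longrightarrow> has_type (g x) w"
  unfolding has_type_def using emb_\<Gamma> by (metis comp_apply)

text \<open>All points of an orbit have one type, and points of one type are separated; freeness
  rules out displacement 0.\<close>

lemma \<Gamma>_displacement:
  obtains d where "0 < d" "\<forall>g\<in>\<Gamma>. g \<noteq> id \<longrightarrow> d \<le> dist x (g x)"
proof -
  obtain w where w: "has_type x w"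
    using has_type_exists by blast
  obtain d where d: "0 < d" "\<And>x y. has_type x w \<Longrightarrow> has_type y w \<Longrightarrow> x \<noteq> y \<Longrightarrow> d \<le> dist x y"
    using has_type_separated by blast
  have "\<forall>g\<in>\<Gamma>. g \<noteq> id \<longrightarrow> d \<le> dist x (g x)"
  proof (intro ballI impI)
    fix g assume g: "g \<in> \<Gamma>" "g \<noteq> id"
    have "x \<noteq> g x"
      using quotient g unfolding compact_quotient_def by metis
    then show "d \<le> dist x (g x)"
      using d(2) w has_type_\<Gamma> g(1) by blast
  qed
  with d(1) show ?thesis
    by (rule that)
qed

section \<open>The metric on the orbit space\<close>

lemma orb_self: "x \<in> orb x"
  using \<Gamma>_id by (force intro: rev_image_eqI)

lemma orb_\<Gamma>:
  assumes "g \<in> \<Gamma>"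
  shows "orb (g x) = orb x"
proof -
  obtain h where h: "h \<in> \<Gamma>" "\<And>x. g (h x) = x" "\<And>x. h (g x) = x"
    using \<Gamma>_inverse[OF assms] by blast
  have "orb (k y) \<subseteq> orb y" if "k \<in> \<Gamma>" for k y
  proof clarify
    fix f assume "f \<in> \<Gamma>"
    then have "f \<circ> k \<in> \<Gamma>"
      using \<Gamma>_comp that by blast
    then show "f (k y) \<in> orb y"
      by (force intro: rev_image_eqI)
  qed
  from this[OF assms, of x] this[OF h(1), of "g x"] show ?thesis
    unfolding h(3) by blast
qed

lemma orbit_space_eq_orb:
  assumes "X \<in> orbit_space \<Gamma>" "x \<in> X"
  shows "X = orb x"
proof -
  obtain a g where "X = orb a" "g \<in> \<Gamma>" "x = g a"
    using assms unfolding orbit_space_def by blast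
  then show ?thesis
    using orb_\<Gamma> by simp
qed

lemma orb_in_orbit_space: "orb x \<in> orbit_space \<Gamma>"
  by (simp add: orbit_space_def)

lemma orbit_space_\<Gamma>: "X \<in> orbit_space \<Gamma> \<Longrightarrow> x \<in> X \<Longrightarrow> g \<in> \<Gamma> \<Longrightarrow> g x \<in> X"
  using orbit_space_eq_orb by blast

text \<open>A pair of points nearly realising the infimum can be moved by \<open>\<Gamma>\<close> so
  that it starts at the prescribed \<open>x\<close>.\<close>

lemma orbit_near:
  assumes X: "X \<in> orbit_space \<Gamma>" "x \<in> X" and Y: "Y \<in> orbit_space \<Gamma>" and "setdist X Y < r"
  obtains y where "y \<in> Y" "dist x y < r"
proof -
  have "X \<noteq> {}" "Y \<noteq> {}"
    using X Y orb_self by (auto simp: orbit_space_def)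
  then obtain x' y' where xy: "x' \<in> X" "y' \<in> Y" "dist x' y' < r"
    using setdist_ltE assms(4) by blast
  then obtain g where g: "g \<in> \<Gamma>" "x = g x'"
    using orbit_space_eq_orb[OF X(1) xy(1)] X(2) by blast
  have "g y' \<in> Y"
    using Y xy(2) g(1) by (rule orbit_space_\<Gamma>)
  moreover have "dist x (g y') < r"
    using g xy(3) by (simp add: \<Gamma>_isometry)
  ultimately show ?thesis
    by (rule that)
qed

text \<open>A nontrivial deck transformation moves \<open>p\<close> by at least \<open>d\<close>, so
  it leaves \<open>b\<close> at distance more than \<open>d / 2\<close> from \<open>a\<close>,
  whereas \<open>a\<close> and \<open>b\<close> are less than \<open>d / 2\<close> apart.\<close>

lemma setdist_orb_local:
  assumes d: "\<forall>g\<in>\<Gamma>. g \<noteq> id \<longrightarrow> d \<le> dist p (g p)"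
    and "dist p a < d / 4" "dist p b < d / 4"
  shows "setdist (orb a) (orb b) = dist a b"
proof (rule antisym)
  show "setdist (orb a) (orb b) \<le> dist a b"
    by (intro setdist_le_dist orb_self)
  show "dist a b \<le> setdist (orb a) (orb b)"
  proof (rule le_setdistI)
    show "orb a \<noteq> {}" "orb b \<noteq> {}"
      using orb_self by blast+
    fix x y assume "x \<in> orb a" "y \<in> orb b"
    then obtain g h where g: "g \<in> \<Gamma>" "x = g a" and h: "h \<in> \<Gamma>" "y = h b"
      by blast
    obtain f where f: "f \<in> \<Gamma>" "\<And>z. g (f z) = z" "\<And>z. f (g z) = z"
      using \<Gamma>_inverse[OF g(1)] by blast
    define k where "k = f \<circ> h"
    have k: "k \<in> \<Gamma>"
      unfolding k_def using f(1) h(1) by (rule \<Gamma>_comp)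
    have xy: "dist x y = dist a (k b)"
      using \<Gamma>_isometry[OF f(1), of x y] f(3) g(2) h(2) by (simp add: k_def)
    show "dist a b \<le> dist x y"
    proof (cases "k = id")
      case False
      have "d \<le> dist p (k p)"
        using d k False by blast
      also have "\<dots> \<le> dist p a + dist a (k b) + dist (k b) (k p)"
        using dist_triangle[of p "k p" a] dist_triangle[of a "k p" "k b"] by linarith
      also have "dist (k b) (k p) = dist p b"
        using \<Gamma>_isometry[OF k] by (simp add: dist_commute)
      finally have "d / 2 \<le> dist x y"
        using assms(2,3) xy by linarith
      moreover have "dist a b \<le> dist p a + dist p b"
        by (rule dist_triangle3)
      ultimately show ?thesis
        using assms(2,3) by linarith
    qed (simp add: xy)
  qed
qed

text \<open>Positivity is the delicate axiom, as an infimum could vanish on distinct orbits; within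
  a small ball, however, the orbit distance equals the distance upstairs.\<close>

lemma Metric_space_orbit_space: "Metric_space (orbit_space \<Gamma>) setdist"
proof
  fix X Y assume X: "X \<in> orbit_space \<Gamma>" and Y: "Y \<in> orbit_space \<Gamma>"
  obtain x where x: "x \<in> X"
    using X orb_self unfolding orbit_space_def by blast
  show "setdist X Y = 0 \<longleftrightarrow> X = Y"
  proof
    assume 0: "setdist X Y = 0"
    obtain d where d: "0 < d" "\<forall>g\<in>\<Gamma>. g \<noteq> id \<longrightarrow> d \<le> dist x (g x)"
      using \<Gamma>_displacement[of x] by blast
    obtain y where y: "y \<in> Y" "dist x y < d / 4"
      using orbit_near[OF X x Y, of "d / 4"] 0 d(1) by auto
    have "dist x y = setdist (orb x) (orb y)"
      using setdist_orb_local[OF d(2), of x y] y(2) d(1) by simp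
    also have "\<dots> = 0"
      using 0 orbit_space_eq_orb[OF X x] orbit_space_eq_orb[OF Y y(1)] by simp
    finally show "X = Y"
      using orbit_space_eq_orb[OF X x] orbit_space_eq_orb[OF Y y(1)] by simp
  qed (simp add: setdist_refl)
  fix Z assume Z: "Z \<in> orbit_space \<Gamma>"
  show "setdist X Z \<le> setdist X Y + setdist Y Z"
  proof (rule field_le_epsilon)
    fix e :: real assume "0 < e"
    then obtain y where y: "y \<in> Y" "dist x y < setdist X Y + e / 2"
      using orbit_near[OF X x Y, of "setdist X Y + e / 2"] by auto
    obtain z where z: "z \<in> Z" "dist y z < setdist Y Z + e / 2"
      using orbit_near[OF Y y(1) Z, of "setdist Y Z + e / 2"] \<open>0 < e\<close> by auto
    have "setdist X Z \<le> dist x z"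
      using x z(1) by (rule setdist_le_dist)
    then show "setdist X Z \<le> setdist X Y + setdist Y Z + e"
      using y z dist_triangle[of x z y] by linarith
  qed
qed (auto simp: setdist_sym)

section \<open>Orbits of a given type\<close>

definition orbits_of_type :: "real^'n \<Rightarrow> 'x set set" where
  "orbits_of_type w = orb ` {x. has_type x w}"

lemma orbits_of_type_subset: "orbits_of_type w \<subseteq> orbit_space \<Gamma>"
  by (auto simp: orbits_of_type_def orb_in_orbit_space)

text \<open>These orbits are \<open>d\<close>-separated in a totally bounded space, and a ball of
  radius \<open>d / 2\<close> contains at most one of them.\<close>

lemma finite_orbits_of_type_w0: "finite (orbits_of_type w0)"
proof -
  interpret Metric_space "orbit_space \<Gamma>" setdist
    by (rule Metric_space_orbit_space)
  obtain d where d: "0 < d"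
    "\<And>x y. has_type x w0 \<Longrightarrow> has_type y w0 \<Longrightarrow> x \<noteq> y \<Longrightarrow> d \<le> dist x y"
    using has_type_separated by blast
  have sep: "d \<le> setdist X Y"
    if XY: "X \<in> orbits_of_type w0" "Y \<in> orbits_of_type w0" "X \<noteq> Y" for X Y
  proof (rule le_setdistI)
    show "X \<noteq> {}" "Y \<noteq> {}"
      using XY orb_self by (auto simp: orbits_of_type_def)
    fix x y assume xy: "x \<in> X" "y \<in> Y"
    then have "has_type x w0" "has_type y w0"
      using XY has_type_\<Gamma> by (auto simp: orbits_of_type_def)
    moreover have "x \<noteq> y"
      using orbit_space_eq_orb xy XY orbits_of_type_subset by blast
    ultimately show "d \<le> dist x y"
      by (rule d(2))
  qed
  have "compactin mtopology (orbit_space \<Gamma>)"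
    using quotient by (simp add: compact_quotient_def compact_space_def)
  then have "mtotally_bounded (orbit_space \<Gamma>)"
    by (rule compactin_imp_mtotally_bounded)
  then obtain K where K: "finite K" "orbit_space \<Gamma> \<subseteq> (\<Union>k\<in>K. mball k (d / 2))"
    using d(1) unfolding mtotally_bounded_def by (metis half_gt_zero)
  have "finite (orbits_of_type w0 \<inter> mball k (d / 2))" for k
  proof (rule ccontr)
    assume inf: "infinite (orbits_of_type w0 \<inter> mball k (d / 2))"
    then obtain X where X: "X \<in> orbits_of_type w0 \<inter> mball k (d / 2)"
      by (metis all_not_in_conv finite.emptyI)
    then obtain Y where Y: "Y \<in> orbits_of_type w0 \<inter> mball k (d / 2)" "Y \<noteq> X"
      using inf by (metis finite.emptyI finite_insert finite_subset insertI1 subsetI)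
    then have "setdist X Y < d"
      using X triangle'[of X k Y] by (auto simp: setdist_sym)
    then show False
      using sep[of X Y] X Y by auto
  qed
  then have "finite (\<Union>k\<in>K. orbits_of_type w0 \<inter> mball k (d / 2))"
    using K(1) by blast
  then show ?thesis
    by (rule rev_finite_subset) (use K(2) orbits_of_type_subset in blast)
qed

text \<open>A chamber is determined by its point of type \<open>w0\<close>, and it has a point of every type.\<close>

lemma orbits_of_type_bounded:
  "finite (orbits_of_type w) \<and> card (orbits_of_type w) \<le> card (orbits_of_type w0)"
proof -
  \<comment> \<open>\<open>X\<close> stands for an orbit of chambers, recorded by their base points;
    \<open>F X\<close> collects the points of type \<open>w\<close> in these chambers.\<close>
  define F where "F X = {\<phi> w | \<phi>. emb \<phi> \<and> \<phi> w0 \<in> X}" for X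
  have "orbits_of_type w \<subseteq> F ` orbits_of_type w0"
  proof
    fix X assume "X \<in> orbits_of_type w"
    then obtain \<psi> where \<psi>: "emb \<psi>" "w \<in> W" "X = orb (\<psi> w)"
      by (auto simp: orbits_of_type_def has_type_def)
    have "X = F (orb (\<psi> w0))"
    proof (intro equalityI subsetI)
      fix x assume "x \<in> X"
      then obtain g where g: "g \<in> \<Gamma>" "x = (g \<circ> \<psi>) w"
        using \<psi>(3) by auto
      moreover have "(g \<circ> \<psi>) w0 \<in> orb (\<psi> w0)"
        using g(1) by simp
      ultimately show "x \<in> F (orb (\<psi> w0))"
        unfolding F_def using emb_\<Gamma>[OF \<psi>(1) g(1)] by blast
    next
      fix x assume "x \<in> F (orb (\<psi> w0))"
      then obtain \<phi> g where \<phi>: "emb \<phi>" "x = \<phi> w" "g \<in> \<Gamma>" "\<phi> w0 = (g \<circ> \<psi>) w0"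
        by (auto simp: F_def)
      then have "\<phi> w = (g \<circ> \<psi>) w"
        using emb_eq_on_W[OF \<phi>(1) emb_\<Gamma>[OF \<psi>(1) \<phi>(3)] w0 w0_W _ \<psi>(2)] by blast
      then show "x \<in> X"
        using \<phi>(2,3) \<psi>(3) by simp
    qed
    moreover have "orb (\<psi> w0) \<in> orbits_of_type w0"
      using \<psi>(1) w0_W by (auto simp: orbits_of_type_def has_type_def)
    ultimately show "X \<in> F ` orbits_of_type w0"
      by blast
  qed
  then show ?thesis
    using finite_orbits_of_type_w0 by (meson card_image_le card_mono finite_imageI finite_subset order_trans)
qed

section \<open>Lifting geodesic segments\<close>

text \<open>Near each time the path lifts isometrically into a small ball around a chosen preimage.
  A deck transformation attaches this piece to the lift built so far, and
  \<open>CAT0_geodesic_extend\<close> keeps the result globally geodesic. Step sizes depend on the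
  time, hence the bisection argument.\<close>

lemma lift_geodesic_segment:
  assumes "geodesic_segment (orbit_space \<Gamma>) setdist \<gamma> L"
  obtains c where "geodesic c L" "\<And>t. t \<in> {0..L} \<Longrightarrow> c t \<in> \<gamma> t"
proof -
  have L: "0 < L" and \<gamma>: "\<And>t. t \<in> {0..L} \<Longrightarrow> \<gamma> t \<in> orbit_space \<Gamma>"
    and loc: "\<And>t. t \<in> {0..L} \<Longrightarrow> \<exists>e>0. \<forall>r\<in>{0..L}. \<forall>s\<in>{0..L}.
        \<bar>r - t\<bar> < e \<and> \<bar>s - t\<bar> < e \<longrightarrow> setdist (\<gamma> r) (\<gamma> s) = \<bar>r - s\<bar>"
    using assms by (auto simp: geodesic_segment_def)
  define P where "P t \<longleftrightarrow> (\<exists>c. geodesic c t \<and> (\<forall>s\<in>{0..t}. c s \<in> \<gamma> s))" for t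
  have step: "\<exists>d>0. \<forall>a b. a \<le> x \<and> x \<le> b \<and> b - a < d \<longrightarrow> 0 \<le> a \<and> b \<le> L \<and> P a \<longrightarrow> P b"
    if x: "0 \<le> x" "x \<le> L" for x
  proof -
    obtain e where e: "0 < e" "\<And>r s. r \<in> {0..L} \<Longrightarrow> s \<in> {0..L} \<Longrightarrow> \<bar>r - x\<bar> < e \<Longrightarrow> \<bar>s - x\<bar> < e \<Longrightarrow>
        setdist (\<gamma> r) (\<gamma> s) = \<bar>r - s\<bar>"
      using loc[of x] x by auto
    obtain p where p: "p \<in> \<gamma> x"
      using \<gamma>[of x] x orb_self by (auto simp: orbit_space_def)
    obtain d where d: "0 < d" "\<forall>g\<in>\<Gamma>. g \<noteq> id \<longrightarrow> d \<le> dist p (g p)"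
      using \<Gamma>_displacement[of p] by blast
    \<comment> \<open>Within \<open>e\<close> the path is isometric, and within \<open>d / 4\<close>
      its orbits have representatives in the ball around \<open>p\<close> on which the orbit map is
      isometric.\<close>
    have "P b" if ab: "a \<le> x" "x \<le> b" "b - a < min e (d / 4)" "0 \<le> a" "b \<le> L" "P a" for a b
    proof -
      obtain c where c: "geodesic c a" "\<And>s. s \<in> {0..a} \<Longrightarrow> c s \<in> \<gamma> s"
        using \<open>P a\<close> by (auto simp: P_def)
      have "\<exists>y. y \<in> \<gamma> s \<and> dist p y < d / 4" if "s \<in> {a..b}" for s
      proof -
        have "\<bar>x - s\<bar> \<le> b - a"
          using that ab by (auto simp: abs_le_iff)
        then have "setdist (\<gamma> x) (\<gamma> s) < d / 4"
          using e(2)[of x s] e(1) that ab x by (simp add: abs_minus_commute)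
        then show ?thesis
          using orbit_near[OF \<gamma> p \<gamma>, of s "d / 4"] that ab x by auto
      qed
      then obtain c' where c': "\<And>s. s \<in> {a..b} \<Longrightarrow> c' s \<in> \<gamma> s"
          "\<And>s. s \<in> {a..b} \<Longrightarrow> dist p (c' s) < d / 4"
        by metis
      have c'_dist: "dist (c' r) (c' s) = \<bar>r - s\<bar>" if rs: "r \<in> {a..b}" "s \<in> {a..b}" for r s
      proof -
        have "dist (c' r) (c' s) = setdist (orb (c' r)) (orb (c' s))"
          using setdist_orb_local[OF d(2) c'(2)[OF rs(1)] c'(2)[OF rs(2)]] by simp
        also have "\<dots> = setdist (\<gamma> r) (\<gamma> s)"
          using orbit_space_eq_orb[OF \<gamma> c'(1), of r] orbit_space_eq_orb[OF \<gamma> c'(1), of s] rs ab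
          by simp
        also have "\<dots> = \<bar>r - s\<bar>"
          using rs ab by (intro e(2)) auto
        finally show ?thesis .
      qed
      have "\<gamma> a = orb (c' a)" "c a \<in> \<gamma> a"
        using orbit_space_eq_orb[OF \<gamma> c'(1), of a] c(2)[of a] ab x by auto
      then obtain k where k: "k \<in> \<Gamma>" "c a = k (c' a)"
        by auto
      define f where "f s = (if s \<le> a then c s else k (c' s))" for s
      have f_right: "f s = k (c' s)" if "a \<le> s" for s
        using that k(2) by (cases "s = a") (auto simp: f_def)
      have f_\<gamma>: "f s \<in> \<gamma> s" if "s \<in> {0..b}" for s
      proof (cases "s \<le> a")
        case True
        then show ?thesis using c(2) that by (simp add: f_def)
      next
        case False
        then have s: "s \<in> {0..L}" "s \<in> {a..b}"
          using that ab by auto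
        show ?thesis
          using orbit_space_\<Gamma>[OF \<gamma>[OF s(1)] c'(1)[OF s(2)] k(1)] f_right[of s] s(2) by simp
      qed
      have f_dist: "dist (f r) (f s) = \<bar>r - s\<bar>" if "r \<in> {a..b}" "s \<in> {a..b}" for r s
        using that c'_dist f_right \<Gamma>_isometry[OF k(1)] by simp
      have "geodesic f b"
      proof (cases "a = 0")
        case True
        then show ?thesis
          using f_dist ab x by (simp add: geodesic_def)
      next
        case False
        obtain e' where e': "0 < e'" "\<And>r s. r \<in> {0..L} \<Longrightarrow> s \<in> {0..L} \<Longrightarrow> \<bar>r - a\<bar> < e' \<Longrightarrow>
            \<bar>s - a\<bar> < e' \<Longrightarrow> setdist (\<gamma> r) (\<gamma> s) = \<bar>r - s\<bar>"
          using loc[of a] ab x by auto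
        obtain d' where d': "0 < d'" "\<forall>g\<in>\<Gamma>. g \<noteq> id \<longrightarrow> d' \<le> dist (f a) (g (f a))"
          using \<Gamma>_displacement[of "f a"] by blast
        have fa: "geodesic f a"
          using c(1) by (simp add: geodesic_def f_def)
        show ?thesis
        proof (rule CAT0_geodesic_extend[OF CAT0 fa])
          \<comment> \<open>The three bounds keep \<open>a - s\<close> nonnegative, both times where
            \<open>\<gamma>\<close> is isometric, and both lifted points in the ball of radius
            \<open>d' / 4\<close> around \<open>f a\<close>.\<close>
          show "a \<le> b" "0 < min a (min (e' / 2) (d' / 8))" "min a (min (e' / 2) (d' / 8)) \<le> a"
            using ab False e' d' by auto
          show "dist (f r) (f s) = \<bar>r - s\<bar>" if "r \<in> {a..b}" "s \<in> {a..b}" for r s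
            using that by (rule f_dist)
          fix s assume s: "0 < s" "s \<le> min a (min (e' / 2) (d' / 8))" "a + s \<le> b"
          have 1: "dist (f a) (f (a - s)) < d' / 4"
            using fa s ab d'(1) by (simp add: geodesic_def)
          have 2: "dist (f a) (f (a + s)) < d' / 4"
            using f_dist[of a "a + s"] s ab d'(1) by simp
          have "dist (f (a - s)) (f (a + s)) = setdist (orb (f (a - s))) (orb (f (a + s)))"
            using setdist_orb_local[OF d'(2) 1 2] by simp
          also have "\<dots> = setdist (\<gamma> (a - s)) (\<gamma> (a + s))"
            using orbit_space_eq_orb[OF \<gamma> f_\<gamma>, of "a - s"] orbit_space_eq_orb[OF \<gamma> f_\<gamma>, of "a + s"]
              s ab by simp
          also have "\<dots> = \<bar>(a - s) - (a + s)\<bar>"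
            using s ab e'(1) by (intro e'(2)) auto
          finally show "dist (f (a - s)) (f (a + s)) = 2 * s"
            using s by simp
        qed
      qed
      then show ?thesis
        unfolding P_def using f_\<gamma> by blast
    qed
    then show ?thesis
      using e(1) d(1) by (intro exI[of _ "min e (d / 4)"]) auto
  qed
  have "P 0"
  proof -
    obtain p where "p \<in> \<gamma> 0"
      using \<gamma>[of 0] L orb_self by (auto simp: orbit_space_def)
    then show ?thesis
      unfolding P_def by (intro exI[of _ "\<lambda>_. p"]) (auto simp: geodesic_def)
  qed
  \<comment> \<open>An implication is transitive, as bisection requires; the bounds confine it to
    the domain of the path.\<close>
  define R where "R a b \<longleftrightarrow> (0 \<le> a \<and> b \<le> L \<and> P a \<longrightarrow> P b)" for a b
  have "R 0 L"
  proof (rule Bolzano[of 0 L R])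
    show "0 \<le> L"
      using L by simp
    show "\<exists>d>0. \<forall>a b. a \<le> x \<and> x \<le> b \<and> b - a < d \<longrightarrow> R a b" if "0 \<le> x" "x \<le> L" for x
      unfolding R_def by (rule step[OF that])
  qed (auto simp: R_def)
  then have "P L"
    using \<open>P 0\<close> by (simp add: R_def)
  then show ?thesis
    using that unfolding P_def by blast
qed

section \<open>The blocking set and its size\<close>

lemma uniform_finite_blocking_quotient: "uniform_finite_blocking (orbit_space \<Gamma>) setdist"
proof -
  obtain K where K: "\<And>p q. p \<in> W \<Longrightarrow> q \<in> W \<Longrightarrow> finite (midpoint_types p q)"
      "\<And>p q. p \<in> W \<Longrightarrow> q \<in> W \<Longrightarrow> card (midpoint_types p q) \<le> K"
    using midpoint_types_bounded by blast
  \<comment> \<open>At most \<open>K\<close> midpoint types, each attained on at most as many orbits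
    as there are orbits of type \<open>w0\<close>; neither factor depends on the endpoints.\<close>
  let ?N = "K * card (orbits_of_type w0)"
  have "\<exists>B. B \<subseteq> orbit_space \<Gamma> \<and> finite B \<and> card B \<le> ?N \<and>
      blocks B (light (orbit_space \<Gamma>) setdist X Y)"
    if X: "X \<in> orbit_space \<Gamma>" and Y: "Y \<in> orbit_space \<Gamma>" for X Y
  proof -
    obtain x y where xy: "X = orb x" "Y = orb y"
      using X Y by (auto simp: orbit_space_def)
    obtain p q where p: "has_type x p" and q: "has_type y q"
      using has_type_exists by metis
    then have pq: "p \<in> W" "q \<in> W"
      by (auto simp: has_type_def)
    let ?B = "\<Union>w\<in>midpoint_types p q. orbits_of_type w"
    have "card ?B \<le> (\<Sum>w\<in>midpoint_types p q. card (orbits_of_type w))"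
      using K(1)[OF pq] by (rule card_UN_le)
    also have "\<dots> \<le> card (midpoint_types p q) * card (orbits_of_type w0)"
      using orbits_of_type_bounded by (intro sum_bounded_above[THEN order_trans]) auto
    also have "\<dots> \<le> ?N"
      using K(2)[OF pq] by simp
    finally have card: "card ?B \<le> ?N" .
    have B: "finite ?B" "?B \<subseteq> orbit_space \<Gamma>"
      using K(1)[OF pq] orbits_of_type_bounded orbits_of_type_subset by auto
    have hit: "\<gamma> ` {0<..<L} \<inter> ?B \<noteq> {}"
      if light: "(\<gamma>, L) \<in> light (orbit_space \<Gamma>) setdist X Y" for \<gamma> L
    proof -
      have seg: "geodesic_segment (orbit_space \<Gamma>) setdist \<gamma> L" "\<gamma> 0 = X" "\<gamma> L = Y"
        using light by (auto simp: light_def)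
      then have L: "0 < L" and \<gamma>: "\<gamma> (L / 2) \<in> orbit_space \<Gamma>"
        by (auto simp: geodesic_segment_def)
      obtain c where c: "geodesic c L" "\<And>t. t \<in> {0..L} \<Longrightarrow> c t \<in> \<gamma> t"
        using lift_geodesic_segment[OF seg(1)] by blast
      have "c 0 \<in> orb x" "c L \<in> orb y"
        using c(2)[of 0] c(2)[of L] L seg xy by auto
      then have "has_type (c 0) p" "has_type (c L) q"
        using p q has_type_\<Gamma> by auto
      then obtain w where w: "w \<in> midpoint_types p q" "has_type (c (L / 2)) w"
        using geodesic_midpoint_type[OF c(1)] by blast
      have "\<gamma> (L / 2) = orb (c (L / 2))"
        using c(2)[of "L / 2"] L \<gamma> by (intro orbit_space_eq_orb) auto
      then have "\<gamma> (L / 2) \<in> ?B"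
        using w by (auto simp: orbits_of_type_def)
      moreover have "L / 2 \<in> {0<..<L}"
        using L by simp
      ultimately show ?thesis
        by blast
    qed
    have "blocks ?B (light (orbit_space \<Gamma>) setdist X Y)"
      unfolding blocks_def using hit by (intro ballI case_prodI2) simp
    then show ?thesis
      using B card by (intro exI[of _ ?B] conjI)
  qed
  then show ?thesis
    unfolding uniform_finite_blocking_def by blast
qed

end

theorem theorem1:
  fixes W :: "(real^'n) set"
    and cells :: "'x::metric_space set set"
    and label :: "'x set \<Rightarrow> (real^'n) set"
    and \<Gamma> :: "('x \<Rightarrow> 'x) set"
  assumes "euclidean_building W cells label"
    and "compact_quotient cells label \<Gamma>"
  shows "uniform_finite_blocking (orbit_space \<Gamma>) setdist"
proof -
  interpret building_quotient W cells label \<Gamma>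
    using assms by unfold_locales
  show ?thesis
    by (rule uniform_finite_blocking_quotient)
qed

end
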